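(* Let $(W_t)_{t\ge 0}$ be a standard Brownian motion with $W_0=0$. Let $b:(0,\infty)\to\mathbb{R}$ be a continuous function with $b(0)\le 0$ (where $b(0):=\lim_{t\downarrow 0}b(t)$, the value $b(0)=-\infty$ being allowed). Let $\tau=\inf\{t>0:\ W_t\le b(t)\}$ and assume that $b$ is regular, i.e. $P(\tau=0)=0$; if $b(0)=-\infty$, assume also that there is $\epsilon>0$ such that $b$ is monotone increasing on $(0,\epsilon]$. Let $F(t)=P(\tau\le t)$. Then for all $p\in\mathbb{R}$, all $t>0$ and all $y<b(t)$, $$\frac{e^{-\frac{y^2}{4t}}D_{p}(-y/\sqrt{t})}{t^{(p+1)/2}}=\int_{0}^t e^{-\frac{(b(s)-y)^2}{4(t-s)}}\,\frac{D_{p}\big((b(s)-y)/\sqrt{t-s}\big)}{(t-s)^{(p+1)/2}}\,F(ds).$$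
   Context: $D_p$ ($p\in\mathbb{R}$) is the parabolic cylinder function: the entire solution of $u''(z)+\left(p+\tfrac12-\tfrac{z^2}{4}\right)u(z)=0$ normalized by $D_p(z)\sim z^p e^{-z^2/4}$ as $z\to+\infty$. For $p<0$, $D_p(z)=\frac{e^{-z^2/4}}{\Gamma(-p)}\int_0^\infty e^{-xz-x^2/2}x^{-p-1}\,dx$. The integral over $s\in(0,t]$ is a Lebesgue–Stieltjes integral with respect to $F$; the integrand at $s=t$ is read as its limit as $s\uparrow t$, which is $0$ since $y<b(t)$. *)

theory Defs
  imports "HOL-Probability.Probability" "HOL-Library.Landau_Symbols"
begin

text \<open>The normalisation along the positive real axis selects the recessive solution of
  Weber's equation; the other solutions grow like a multiple of
  \<open>z powr (- p - 1) * exp (z\<^sup>2 / 4)\<close>, so it determines \<open>u\<close> uniquely.\<close>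

definition is_parabolic_cylinder :: "real \<Rightarrow> (complex \<Rightarrow> complex) \<Rightarrow> bool" where
  "is_parabolic_cylinder p u \<longleftrightarrow>
     u holomorphic_on UNIV \<and>
     (\<forall>z. deriv (deriv u) z + (of_real p + 1 / 2 - z\<^sup>2 / 4) * u z = 0) \<and>
     (\<lambda>x::real. u (of_real x)) \<sim>[at_top] (\<lambda>x. of_real (x powr p * exp (- x\<^sup>2 / 4)))"

definition parabolic_cylinder :: "real \<Rightarrow> complex \<Rightarrow> complex" where
  "parabolic_cylinder p = (THE u. is_parabolic_cylinder p u)"

text \<open>For real \<open>p\<close> the function is real on the real axis, so taking the real part there
  loses nothing.\<close>

definition parabolic_cylinder_real :: "real \<Rightarrow> real \<Rightarrow> real" where
  "parabolic_cylinder_real p x = Re (parabolic_cylinder p (of_real x))"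

locale standard_brownian_motion = prob_space M
  for M :: "'a measure" +
  fixes W :: "real \<Rightarrow> 'a \<Rightarrow> real"
  assumes random_variable: "0 \<le> t \<Longrightarrow> random_variable borel (W t)"
    and start_zero: "\<omega> \<in> space M \<Longrightarrow> W 0 \<omega> = 0"
    and continuous_paths: "\<omega> \<in> space M \<Longrightarrow> continuous_on {0..} (\<lambda>t. W t \<omega>)"
    and normal_increments: "0 \<le> s \<Longrightarrow> s < t \<Longrightarrow>
      distributed M lborel (\<lambda>\<omega>. W t \<omega> - W s \<omega>) (normal_density 0 (sqrt (t - s)))"
    and independent_increments: "0 \<le> r 0 \<Longrightarrow> (\<And>i. i < n \<Longrightarrow> r i \<le> r (Suc i)) \<Longrightarrow>
      indep_vars (\<lambda>_. borel) (\<lambda>i \<omega>. W (r (Suc i)) \<omega> - W (r i) \<omega>) {..<n::nat}"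

text \<open>Extended-real valued, so that the passage time is \<open>\<infinity>\<close> if the boundary is never hit.\<close>

definition passage_time :: "(real \<Rightarrow> 'a \<Rightarrow> real) \<Rightarrow> (real \<Rightarrow> real) \<Rightarrow> 'a \<Rightarrow> ereal" where
  "passage_time W b \<omega> = Inf {ereal t |t. 0 < t \<and> W t \<omega> \<le> b t}"

definition passage_cdf ::
  "'a measure \<Rightarrow> (real \<Rightarrow> 'a \<Rightarrow> real) \<Rightarrow> (real \<Rightarrow> real) \<Rightarrow> real \<Rightarrow> real" where
  "passage_cdf M W b t = measure M {\<omega> \<in> space M. passage_time W b \<omega> \<le> ereal t}"

end

theory Submission
  imports Defs "HOL-Complex_Analysis.Complex_Analysis" "HOL-Real_Asymp.Real_Asymp"
begin

text \<open>
  Put \<open>g\<^sub>p x = exp (- x\<^sup>2 / 4) * D\<^sub>p x\<close> and \<open>h\<^sub>p r x = g\<^sub>p (x / sqrt r) / r powr ((p + 1) / 2)\<close>. Then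
  \<open>\<partial>\<^sub>x h\<^sub>p = - h\<^bsub>p+1\<^esub>\<close>, and the claim reads \<open>h\<^sub>p t (- y) = \<integral> h\<^sub>p (t - s) (b s - y) F(ds)\<close>. Up to the
  factor \<open>sqrt (2 * pi)\<close>, \<open>h\<^bsub>-1\<^esub> r x\<close> is the probability that a centred normal variable of
  variance \<open>r\<close> exceeds \<open>x\<close>, so for \<open>p = -1\<close> the claim is the strong Markov property at \<open>\<tau>\<close>, since
  \<open>W\<^sub>t \<le> y < b t\<close> forces \<open>\<tau> < t\<close>, and \<open>W\<^sub>\<tau> = b \<tau>\<close>. Differentiation in \<open>y\<close> passes from \<open>p\<close> to \<open>p + 1\<close>; it is
  justified by dominated convergence because \<open>h\<^sub>p\<close> is bounded along the boundary for \<open>p > -1\<close>.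
  Finally, for \<open>p < 0\<close> the function \<open>h\<^sub>p\<close> is a mixture of translates of the Gaussian kernel \<open>h\<^sub>0\<close>,
  and Tonelli's theorem passes from \<open>p = 0\<close> to all \<open>p < 0\<close>, hence to all \<open>p\<close>.
\<close>

section \<open>Uniqueness of the parabolic cylinder function\<close>

text \<open>The definite description behind \<open>parabolic_cylinder\<close> says nothing until
  existence and uniqueness are known. For p < 0 an integral provides the function; higher orders
  come from differentiation. The recursion carries \<open>g\<close> together with
  \<open>- deriv g\<close>: asymptotics of a derivative cannot be read off from those of the
  function, but the differential equation yields those of g'' from those of g and g'.

  The Markov argument is run on time grids, where only independence of increments is needed. Order
  -1 is the right start because its kernel is a multiple of a probability, hence bounded up to s =
  t.

  Unit steps from -1 would reach integers only. Mixing the identity of order 0 over the points y - u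
  with u > 0, all still below b(t), gives every negative order, fractional ones included.\<close>

lemma entire_eqI_of_eventually_real:
  assumes "f holomorphic_on UNIV" "g holomorphic_on UNIV"
    and "eventually (\<lambda>x::real. f (of_real x) = g (of_real x)) at_top"
  shows "f = g"
proof
  fix w
  obtain X where X: "\<And>x. x \<ge> X \<Longrightarrow> f (of_real x) = g (of_real x)"
    using assms(3) by (auto simp: eventually_at_top_linorder)
  let ?U = "of_real ` {X..X+1} :: complex set"
  have lim: "of_real X islimpt ?U"
  proof (rule connected_imp_perfect)
    show "connected ?U"
      by (intro connected_continuous_image continuous_intros) auto
    show "(of_real X :: complex) \<in> ?U" by auto
    show "?U \<noteq> {a}" for a
    proof
      assume "?U = {a}"
      moreover have "(of_real X :: complex) \<in> ?U" "of_real (X+1) \<in> ?U"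
        by (auto simp del: of_real_add)
      ultimately have "of_real X = (of_real (X+1) :: complex)" by (metis singletonD)
      then show False by (simp only: of_real_eq_iff)
    qed
  qed
  have hol: "(\<lambda>z. f z - g z) holomorphic_on UNIV"
    using assms(1,2) by (rule holomorphic_on_diff)
  have eq: "f z - g z = 0" if "z \<in> ?U" for z
  proof -
    from that obtain x where "x \<ge> X" "z = of_real x" by auto
    with X[of x] show ?thesis by simp
  qed
  have "f w - g w = 0"
    by (rule analytic_continuation[OF hol _ _ _ _ lim eq]) (simp_all add: connected_UNIV)
  then show "f w = g w" by simp
qed

text \<open>The substitution \<open>g z = exp (- z\<^sup>2 / 4) * D\<^sub>p z\<close> turns differentiation into the index shift
  \<open>g\<^sub>p' = - g\<^bsub>p+1\<^esub>\<close>.\<close>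

definition gauss_cylinder :: "real \<Rightarrow> (complex \<Rightarrow> complex) \<Rightarrow> bool" where
  "gauss_cylinder p g \<longleftrightarrow>
     g holomorphic_on UNIV \<and>
     (\<forall>z. deriv (deriv g) z + z * deriv g z + of_real (p + 1) * g z = 0) \<and>
     ((\<lambda>x::real. g (of_real x) / of_real (x powr p * exp (- x\<^sup>2 / 2))) \<longlongrightarrow> 1) at_top"

lemma gauss_cylinder_ode:
  assumes "gauss_cylinder p g"
  shows "deriv (deriv g) z = - z * deriv g z - of_real (p + 1) * g z"
proof -
  have "deriv (deriv g) z + z * deriv g z + of_real (p + 1) * g z = 0"
    using assms unfolding gauss_cylinder_def by blast
  then show ?thesis by algebra
qed

lemma holomorphic_UNIV_has_deriv:
  "f holomorphic_on UNIV \<Longrightarrow> (f has_field_derivative deriv f z) (at z)"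
  by (simp add: holomorphic_derivI)

lemma deriv_holomorphic_UNIV: "f holomorphic_on UNIV \<Longrightarrow> deriv f holomorphic_on UNIV"
  by (simp add: holomorphic_deriv)

lemma deriv_exp_mult:
  assumes "u holomorphic_on UNIV"
  defines "e \<equiv> \<lambda>z::complex. exp (- z\<^sup>2 / 4)"
  shows "deriv (\<lambda>z. e z * u z) z = e z * (deriv u z - z / 2 * u z)"
    and "deriv (deriv (\<lambda>z. e z * u z)) z =
      e z * (deriv (deriv u) z - z * deriv u z + (z\<^sup>2 / 4 - 1 / 2) * u z)"
proof -
  note [derivative_intros] = holomorphic_UNIV_has_deriv[OF assms(1)]
    holomorphic_UNIV_has_deriv[OF deriv_holomorphic_UNIV[OF assms(1)]]
  have *: "deriv (\<lambda>z. e z * u z) = (\<lambda>z. e z * (deriv u z - z / 2 * u z))"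
    unfolding e_def by (intro ext DERIV_imp_deriv) (auto intro!: derivative_eq_intros simp: field_simps)
  then show "deriv (\<lambda>z. e z * u z) z = e z * (deriv u z - z / 2 * u z)" by simp
  show "deriv (deriv (\<lambda>z. e z * u z)) z =
      e z * (deriv (deriv u) z - z * deriv u z + (z\<^sup>2 / 4 - 1 / 2) * u z)"
    unfolding * unfolding e_def
    by (intro DERIV_imp_deriv)
       (auto intro!: derivative_eq_intros simp: field_simps power2_eq_square)
qed

text \<open>Multiplication by the zero-free factor \<open>exp (- z^2 / 4)\<close> preserves being
  entire, carries Weber's equation to the one in \<open>gauss_cylinder\<close>, and changes the
  normalising \<open>exp (- x^2 / 4)\<close> into \<open>exp (- x^2 / 2)\<close>.\<close>

lemma is_parabolic_cylinder_iff_gauss_cylinder: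
  "is_parabolic_cylinder p u \<longleftrightarrow> gauss_cylinder p (\<lambda>z. exp (- z\<^sup>2 / 4) * u z)"
proof -
  let ?g = "\<lambda>z. exp (- z\<^sup>2 / 4) * u z"
  have hol: "u holomorphic_on UNIV \<longleftrightarrow> ?g holomorphic_on UNIV"
  proof
    assume "?g holomorphic_on UNIV"
    then have "(\<lambda>z. exp (z\<^sup>2 / 4) * ?g z) holomorphic_on UNIV"
      by (rule holomorphic_on_mult[rotated]) (auto intro!: holomorphic_intros)
    moreover have "(\<lambda>z. exp (z\<^sup>2 / 4) * ?g z) = u"
      by (auto simp: fun_eq_iff exp_minus field_simps)
    ultimately show "u holomorphic_on UNIV" by simp
  next
    assume "u holomorphic_on UNIV"
    then show "?g holomorphic_on UNIV"
      by (intro holomorphic_intros) auto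
  qed
  have ode: "deriv (deriv ?g) z + z * deriv ?g z + of_real (p + 1) * ?g z =
      exp (- z\<^sup>2 / 4) * (deriv (deriv u) z + (of_real p + 1 / 2 - z\<^sup>2 / 4) * u z)"
    if "u holomorphic_on UNIV" for z
    by (simp only: deriv_exp_mult[OF that]) (simp add: algebra_simps power2_eq_square)
  have quot: "?g (of_real x) / of_real (x powr p * exp (- x\<^sup>2 / 2)) =
      u (of_real x) / of_real (x powr p * exp (- x\<^sup>2 / 4))" for x :: real
  proof -
    have "exp (- (of_real x :: complex)\<^sup>2 / 4) = of_real (exp (- x\<^sup>2 / 4))"
      by (simp add: exp_of_real[symmetric])
    moreover have "exp (- x\<^sup>2 / 2) = exp (- x\<^sup>2 / 4) * exp (- x\<^sup>2 / 4)"
      by (simp add: exp_add[symmetric])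
    ultimately show ?thesis by (simp add: field_simps)
  qed
  let ?d = "\<lambda>x. of_real (x powr p * exp (- x\<^sup>2 / 4)) :: complex"
  have "((\<lambda>x::real. u (of_real x)) \<sim>[at_top] ?d) \<longleftrightarrow>
      ((\<lambda>x::real. ?g (of_real x) / of_real (x powr p * exp (- x\<^sup>2 / 2))) \<longlongrightarrow> 1) at_top"
    unfolding quot
  proof
    \<comment> \<open>Asymptotic equivalence counts 0/0 as 1, so passing to the plain quotient
      requires an eventually nonzero denominator.\<close>
    have ev: "eventually (\<lambda>x. ?d x \<noteq> 0) at_top"
      using eventually_gt_at_top[of 0] by eventually_elim auto
    assume "(\<lambda>x::real. u (of_real x)) \<sim>[at_top] ?d"
    from asymp_equivD[OF this] show "((\<lambda>x. u (of_real x) / ?d x) \<longlongrightarrow> 1) at_top"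
      by (rule Lim_transform_eventually) (use ev in eventually_elim, auto)
  qed (rule asymp_equivI')
  with hol ode show ?thesis
    by (auto simp: is_parabolic_cylinder_def gauss_cylinder_def)
qed

lemma of_real_deriv:
  assumes "f holomorphic_on UNIV"
  shows "((\<lambda>x::real. f (of_real x)) has_vector_derivative deriv f (of_real x)) (at x)"
  using field_vector_diff_chain_at[OF has_vector_derivative_of_real[OF DERIV_ident],
      of f "deriv f (of_real x)" x] holomorphic_UNIV_has_deriv[OF assms]
  by (simp add: o_def)

lemma Re_of_real_mult_minus: "Re (- of_real a * z) = - a * Re z"
  by simp

text \<open>If two solutions differ by \<open>w\<close>, their Wronskian is \<open>c * exp (- z\<^sup>2 / 2)\<close>, so
  \<open>(w / g)'\<close> grows like \<open>c * exp (x\<^sup>2 / 2)\<close> on the real axis unless \<open>c = 0\<close>, although \<open>w / g\<close>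
  tends to \<open>0\<close>.\<close>

lemma gauss_cylinder_unique:
  assumes g: "gauss_cylinder p g" and v: "gauss_cylinder p v"
  shows "g = v"
proof -
  define w where "w = (\<lambda>z. v z - g z)"
  have hg: "g holomorphic_on UNIV" and hv: "v holomorphic_on UNIV"
    using g v by (auto simp: gauss_cylinder_def)
  have hw: "w holomorphic_on UNIV" unfolding w_def by (intro holomorphic_intros hg hv)
  note hol = hg hv hw
  note D[derivative_intros] = hol[THEN holomorphic_UNIV_has_deriv]
    hol[THEN deriv_holomorphic_UNIV, THEN holomorphic_UNIV_has_deriv]
  have dw: "deriv w = (\<lambda>z. deriv v z - deriv g z)"
    unfolding w_def by (intro ext DERIV_imp_deriv derivative_intros)
  have ddw: "deriv (deriv w) = (\<lambda>z. deriv (deriv v) z - deriv (deriv g) z)"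
    unfolding dw by (intro ext DERIV_imp_deriv derivative_intros)
  have og: "deriv (deriv g) z = - z * deriv g z - of_real (p + 1) * g z" for z
    using gauss_cylinder_ode[OF g] .
  have ov: "deriv (deriv v) z = - z * deriv v z - of_real (p + 1) * v z" for z
    using gauss_cylinder_ode[OF v] .
  have ow: "deriv (deriv w) z = - z * deriv w z - of_real (p + 1) * w z" for z
    unfolding ddw unfolding dw by (simp add: og ov w_def algebra_simps)
  have "\<exists>c. \<forall>z. exp (z\<^sup>2 / 2) * (w z * deriv g z - deriv w z * g z) = c"
  proof (rule has_field_derivative_zero_constant[of UNIV, simplified])
    fix z
    show "((\<lambda>z. exp (z\<^sup>2 / 2) * (w z * deriv g z - deriv w z * g z)) has_field_derivative 0) (at z)"
      by (auto intro!: derivative_eq_intros) (simp add: og ow algebra_simps power2_eq_square)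
  qed
  then obtain c where c: "\<And>z. exp (z\<^sup>2 / 2) * (w z * deriv g z - deriv w z * g z) = c" by blast
  define d where "d = (\<lambda>x. complex_of_real (x powr p * exp (- x\<^sup>2 / 2)))"
  define \<phi> where "\<phi> = (\<lambda>x::real. w (of_real x) / g (of_real x))"
  define R where "R = (\<lambda>x::real. g (of_real x) / d x)"
  have R: "(R \<longlongrightarrow> 1) at_top" using g by (simp add: gauss_cylinder_def R_def d_def)
  have Rv: "((\<lambda>x::real. v (of_real x) / d x) \<longlongrightarrow> 1) at_top"
    using v by (simp add: gauss_cylinder_def d_def)
  have d0: "eventually (\<lambda>x. d x \<noteq> 0) at_top"
    using eventually_gt_at_top[of 0] by eventually_elim (auto simp: d_def)
  have R0: "eventually (\<lambda>x. R x \<noteq> 0) at_top"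
    using tendsto_imp_eventually_ne[OF R, of 0] by simp
  have g0: "eventually (\<lambda>x::real. g (of_real x) \<noteq> 0) at_top"
    using R0 by eventually_elim (auto simp: R_def)
  have \<phi>0: "(\<phi> \<longlongrightarrow> 0) at_top"
  proof -
    have "((\<lambda>x. v (of_real x) / d x / R x - 1) \<longlongrightarrow> 1 / 1 - 1) at_top"
      by (intro tendsto_intros R Rv) auto
    then have "((\<lambda>x. v (of_real x) / d x / R x - 1) \<longlongrightarrow> 0) at_top" by simp
    then show ?thesis
      by (rule Lim_transform_eventually)
        (use d0 g0 in \<open>eventually_elim, auto simp: \<phi>_def w_def R_def field_simps\<close>)
  qed
  have d\<phi>: "(\<phi> has_vector_derivative - c * exp (- (of_real x)\<^sup>2 / 2) / (g (of_real x))\<^sup>2) (at x)"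
    if "g (of_real x) \<noteq> 0" for x
  proof -
    let ?z = "of_real x :: complex"
    have "((\<lambda>z. w z / g z) has_field_derivative (deriv w ?z * g ?z - w ?z * deriv g ?z) / (g ?z * g ?z))
        (at ?z)"
      using that by (auto intro!: derivative_eq_intros)
    also have "(deriv w ?z * g ?z - w ?z * deriv g ?z) = - c * exp (- ?z\<^sup>2 / 2)"
      using c[of ?z, symmetric] by (simp add: exp_minus field_simps)
    finally have "((\<lambda>z. w z / g z) has_field_derivative - c * exp (- ?z\<^sup>2 / 2) / (g ?z)\<^sup>2) (at ?z)"
      by (simp add: power2_eq_square)
    then show ?thesis
      using field_vector_diff_chain_at[OF has_vector_derivative_of_real[OF DERIV_ident],
          of "\<lambda>z. w z / g z" _ x]
      by (simp add: o_def \<phi>_def)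
  qed
  have "c = 0"
  proof (rule ccontr)
    assume c0: "c \<noteq> 0"
    \<comment> \<open>Since \<open>g = R * d\<close>, the derivative of \<open>\<phi> / c\<close> is
      \<open>- x powr (- 2 * p) * exp (x^2 / 2) / R^2\<close>. With
      \<open>Re (1 / R^2) > 1 / 2\<close> and the real factor at least 2, its real part is at most
      -1.\<close>
    have "((\<lambda>x. Re (1 / (R x)\<^sup>2)) \<longlongrightarrow> Re (1 / 1\<^sup>2)) at_top"
      by (intro tendsto_intros R) auto
    then have e1: "eventually (\<lambda>x. Re (1 / (R x)\<^sup>2) > 1 / 2) at_top"
      by (rule order_tendstoD) simp
    have e2: "eventually (\<lambda>x::real. x powr (- 2 * p) * exp (x\<^sup>2 / 2) \<ge> 2) at_top"
      by real_asymp
    have e3: "eventually (\<lambda>x. Re (- exp (- (of_real x)\<^sup>2 / 2) / (g (of_real x))\<^sup>2) \<le> -1) at_top"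
      using e1 e2 d0 eventually_gt_at_top[of 0]
    proof eventually_elim
      case (elim x)
      have "- exp (- (of_real x)\<^sup>2 / 2) / (g (of_real x))\<^sup>2 =
          - of_real (exp (- x\<^sup>2 / 2) / (x powr p * exp (- x\<^sup>2 / 2))\<^sup>2) * (1 / (R x)\<^sup>2)"
        using elim by (simp add: R_def d_def power_divide field_simps exp_of_real[symmetric])
      also have "exp (- x\<^sup>2 / 2) / (x powr p * exp (- x\<^sup>2 / 2))\<^sup>2 = x powr (- 2 * p) * exp (x\<^sup>2 / 2)"
      proof -
        have "x powr (- 2 * p) = inverse ((x powr p)\<^sup>2)"
          using elim by (simp add: powr_minus[symmetric] powr_power mult.commute)
        then show ?thesis
          using elim by (simp add: exp_minus power2_eq_square divide_simps)
      qed
      finally have "Re (- exp (- (of_real x)\<^sup>2 / 2) / (g (of_real x))\<^sup>2) =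
          - (x powr (- 2 * p) * exp (x\<^sup>2 / 2)) * Re (1 / (R x)\<^sup>2)"
        by (simp only: Re_of_real_mult_minus)
      also have "\<dots> \<le> -1"
        using mult_mono[OF elim(2) less_imp_le[OF elim(1)]] elim by (simp add: mult.commute)
      finally show ?case .
    qed
    obtain X where X: "\<And>x. x \<ge> X \<Longrightarrow> g (of_real x) \<noteq> 0"
        "\<And>x. x \<ge> X \<Longrightarrow> Re (- exp (- (of_real x)\<^sup>2 / 2) / (g (of_real x))\<^sup>2) \<le> -1"
      using eventually_conj[OF g0 e3] by (auto simp: eventually_at_top_linorder)
    \<comment> \<open>Dividing by c removes an unknown complex phase. The mean value theorem for the
      real part then gives a drop of at least 1 over each unit interval, impossible for a function
      with limit 0.\<close>
    have step: "Re (\<phi> (x + 1) / c) - Re (\<phi> x / c) \<le> -1" if "x \<ge> X" for x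
    proof -
      have "((\<lambda>x. Re (\<phi> x / c)) has_real_derivative
          Re (- exp (- (of_real u)\<^sup>2 / 2) / (g (of_real u))\<^sup>2)) (at u)" if "u \<ge> x" for u
      proof -
        have "((\<lambda>x. \<phi> x / c) has_vector_derivative - exp (- (of_real u)\<^sup>2 / 2) / (g (of_real u))\<^sup>2) (at u)"
          using bounded_linear.has_vector_derivative[OF bounded_linear_divide d\<phi>[of u], of c]
            X(1)[of u] that \<open>x \<ge> X\<close> c0 by (simp add: field_simps)
        then show ?thesis
          using has_field_derivative_Re by blast
      qed
      then obtain \<xi> where "\<xi> > x" "Re (\<phi> (x + 1) / c) - Re (\<phi> x / c) =
          (x + 1 - x) * Re (- exp (- (of_real \<xi>)\<^sup>2 / 2) / (g (of_real \<xi>))\<^sup>2)"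
        using MVT2[of x "x + 1" "\<lambda>x. Re (\<phi> x / c)"
            "\<lambda>u. Re (- exp (- (of_real u)\<^sup>2 / 2) / (g (of_real u))\<^sup>2)"] by auto
      with X(2)[of \<xi>] that show ?thesis by simp
    qed
    have l: "((\<lambda>x. Re (\<phi> x / c)) \<longlongrightarrow> Re (0 / c)) at_top"
      by (intro tendsto_intros \<phi>0 c0)
    have "((\<lambda>x. Re (\<phi> (x + 1) / c)) \<longlongrightarrow> Re (0 / c)) at_top"
      by (rule filterlim_compose[OF l]) real_asymp
    from tendsto_diff[OF this l] have "((\<lambda>x. Re (\<phi> (x + 1) / c) - Re (\<phi> x / c)) \<longlongrightarrow> 0) at_top"
      by simp
    moreover have "eventually (\<lambda>x. Re (\<phi> (x + 1) / c) - Re (\<phi> x / c) \<le> -1) at_top"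
      using step by (auto simp: eventually_at_top_linorder)
    ultimately have "0 \<le> (-1::real)"
      by (rule tendsto_upperbound) auto
    then show False by simp
  qed
  obtain X where X: "\<And>x. x \<ge> X \<Longrightarrow> g (of_real x) \<noteq> 0"
    using g0 by (auto simp: eventually_at_top_linorder)
  \<comment> \<open>With c = 0 the quotient \<open>\<phi>\<close> is constant on a ray, hence equal
    to its limit 0 there.\<close>
  have "\<exists>k. \<forall>x\<in>{X..}. \<phi> x = k"
  proof (rule has_vector_derivative_zero_constant)
    show "(\<phi> has_vector_derivative 0) (at x within {X..})" if "x \<in> {X..}" for x
      using d\<phi>[of x] X[of x] that \<open>c = 0\<close> by (auto intro: has_vector_derivative_at_within)
  qed auto
  then obtain k where k: "\<And>x. x \<ge> X \<Longrightarrow> \<phi> x = k" by auto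
  have "(\<phi> \<longlongrightarrow> k) at_top"
    using k by (intro tendsto_eventually) (auto simp: eventually_at_top_linorder)
  then have "k = 0" by (rule tendsto_unique[OF _ _ \<phi>0, rotated]) simp
  have "eventually (\<lambda>x::real. g (of_real x) = v (of_real x)) at_top"
    unfolding eventually_at_top_linorder
  proof (intro exI allI impI)
    fix x assume "X \<le> x"
    then show "g (of_real x) = v (of_real x)"
      using k[of x] X[of x] \<open>k = 0\<close> by (simp add: \<phi>_def w_def)
  qed
  then show ?thesis by (rule entire_eqI_of_eventually_real[OF hg hv])
qed

section \<open>Existence of the parabolic cylinder function\<close>

definition weber_integral :: "real \<Rightarrow> real \<Rightarrow> real" where
  "weber_integral a z = (LINT u:{0<..}|lborel. u powr (a - 1) * exp (- z * u - u\<^sup>2 / 2))"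

lemma Gamma_set_integral:
  assumes "a > (0::real)"
  shows "set_integrable lborel {0<..} (\<lambda>u. u powr (a - 1) * exp (- u))" (is ?th1)
    and "(LINT u:{0<..}|lborel. u powr (a - 1) * exp (- u)) = Gamma a" (is ?th2)
proof -
  let ?h = "\<lambda>u. indicator {0<..} u *\<^sub>R (u powr (a - 1) * exp (- u))"
  have "((\<lambda>t. t powr (a - 1) / exp t) has_integral Gamma a) {0..}"
    by (rule Gamma_integral_real) fact
  then have "((\<lambda>t. if t \<in> {0..} then t powr (a - 1) / exp t else 0) has_integral Gamma a) UNIV"
    by (rule has_integral_restrict_UNIV[THEN iffD2])
  also have "(\<lambda>t. if t \<in> {0..} then t powr (a - 1) / exp t else 0) = ?h"
    by (auto simp: fun_eq_iff exp_minus field_simps indicator_def)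
  finally have "(?h has_integral Gamma a) UNIV" .
  then have "(\<integral>\<^sup>+u. ?h u \<partial>lborel) = ennreal (Gamma a)"
    by (intro nn_integral_has_integral_lborel) (auto simp: indicator_def)
  then have "has_bochner_integral lborel ?h (Gamma a)"
    using assms by (intro has_bochner_integral_nn_integral) (auto simp: indicator_def Gamma_real_nonneg)
  then show ?th1 ?th2
    by (auto simp: has_bochner_integral_iff set_integrable_def set_lebesgue_integral_def)
qed

lemma weber_integrable:
  fixes a z :: real
  assumes "a > 0"
  shows "set_integrable lborel {0<..} (\<lambda>u. u powr (a - 1) * exp (- z * u - u\<^sup>2 / 2))"
proof (rule set_integrable_bound)
  show "set_integrable lborel {0<..} (\<lambda>u. exp ((1 + \<bar>z\<bar>)\<^sup>2 / 2) * (u powr (a - 1) * exp (- u)))"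
    by (intro set_integrable_mult_right Gamma_set_integral assms)
  show "set_borel_measurable lborel {0<..} (\<lambda>u. u powr (a - 1) * exp (- z * u - u\<^sup>2 / 2))"
    by (auto simp: set_borel_measurable_def)
  have "u powr (a - 1) * exp (- z * u - u\<^sup>2 / 2) \<le>
      exp ((1 + \<bar>z\<bar>)\<^sup>2 / 2) * (u powr (a - 1) * exp (- u))" if "u > 0" for u
  proof -
    \<comment> \<open>Completing the square bounds \<open>(1 + \<bar>z\<bar>) * u - u^2 / 2\<close>
      by \<open>(1 + \<bar>z\<bar>)^2 / 2\<close>; the extra 1 leaves a factor
      \<open>exp (- u)\<close>, so that a multiple of the Gamma integrand dominates.\<close>
    have "0 \<le> (1 + \<bar>z\<bar> - u)\<^sup>2" by simp
    then have "0 \<le> (1 + \<bar>z\<bar>)\<^sup>2 - 2 * (1 + \<bar>z\<bar>) * u + u\<^sup>2"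
      by (simp add: power2_diff)
    moreover have "- z * u \<le> \<bar>z\<bar> * u" using that by (intro mult_right_mono) auto
    ultimately have "- z * u - u\<^sup>2 / 2 \<le> (1 + \<bar>z\<bar>)\<^sup>2 / 2 + (- u)"
      by (simp add: algebra_simps)
    then have "exp (- z * u - u\<^sup>2 / 2) \<le> exp ((1 + \<bar>z\<bar>)\<^sup>2 / 2) * exp (- u)"
      unfolding exp_add[symmetric] by (subst exp_le_cancel_iff)
    from mult_left_mono[OF this, of "u powr (a - 1)"] show ?thesis by (simp add: mult_ac)
  qed
  then show "AE u in lborel. u \<in> {0<..} \<longrightarrow> norm (u powr (a - 1) * exp (- z * u - u\<^sup>2 / 2)) \<le>
      norm (exp ((1 + \<bar>z\<bar>)\<^sup>2 / 2) * (u powr (a - 1) * exp (- u)))"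
    by (auto simp: abs_mult)
qed

text \<open>Integration by parts: \<open>u powr a * exp (- z * u - u^2 / 2)\<close> vanishes at
  infinity and, because a > 0, at 0, so its derivative integrates to 0. The recurrence supplies both
  the differential equation and the index shift below.\<close>

lemma weber_integral_recurrence:
  assumes "a > 0"
  shows "a * weber_integral a z = z * weber_integral (a + 1) z + weber_integral (a + 2) z"
proof -
  let ?e = "\<lambda>u. exp (- z * u - u\<^sup>2 / 2)"
  let ?f = "\<lambda>u. a * (u powr (a - 1) * ?e u) - z * (u powr (a + 1 - 1) * ?e u) - u powr (a + 2 - 1) * ?e u"
  have int: "set_integrable lborel {0<..} ?f"
    by (intro set_integral_diff set_integrable_mult_right weber_integrable) (use assms in auto)
  have ein: "einterval 0 \<infinity> = {0<..}" by (auto simp: einterval_def)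
  have "(LBINT u=0..\<infinity>. ?f u) = 0 - 0"
  proof (rule interval_integral_FTC_integrable)
    show "set_integrable lborel (einterval 0 \<infinity>) ?f" using int by (simp only: ein)
    show "((\<lambda>u. u powr a * ?e u) has_vector_derivative ?f u) (at u)" if "0 < ereal u" for u
    proof -
      have "u > 0" using that by simp
      moreover from this have "u powr a = u * u powr (a - 1)" "u powr (a + 1) = u * u powr a"
        by (simp_all add: powr_diff powr_add)
      ultimately show ?thesis unfolding has_real_derivative_iff_has_vector_derivative[symmetric]
        by (auto intro!: derivative_eq_intros simp: algebra_simps)
    qed
    show "isCont ?f u" if "0 < ereal u" for u
      using that by (intro continuous_intros) auto
    have "((\<lambda>u. u powr a * ?e u) \<longlongrightarrow> 0) (at_right 0)"
      using assms by real_asymp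
    then show "(((\<lambda>u. u powr a * ?e u) \<circ> real_of_ereal) \<longlongrightarrow> 0) (at_right 0)"
      by (simp add: zero_ereal_def ereal_tendsto_simps)
    have "((\<lambda>u. u powr a * ?e u) \<longlongrightarrow> 0) at_top"
      by real_asymp
    then show "(((\<lambda>u. u powr a * ?e u) \<circ> real_of_ereal) \<longlongrightarrow> 0) (at_left \<infinity>)"
      by (simp add: ereal_tendsto_simps)
  qed auto
  then have "(LINT u:{0<..}|lborel. ?f u) = 0"
    by (simp add: interval_lebesgue_integral_def ein)
  moreover have "(LINT u:{0<..}|lborel. ?f u) =
      a * weber_integral a z - z * weber_integral (a + 1) z - weber_integral (a + 2) z"
  proof -
    note I = weber_integrable[of a z] weber_integrable[of "a + 1" z] weber_integrable[of "a + 2" z]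
    have "(LINT u:{0<..}|lborel. ?f u) = (LINT u:{0<..}|lborel. a * (u powr (a - 1) * ?e u) -
        z * (u powr (a + 1 - 1) * ?e u)) - (LINT u:{0<..}|lborel. u powr (a + 2 - 1) * ?e u)"
      using I assms by (intro set_integral_diff set_integrable_mult_right) auto
    also have "(LINT u:{0<..}|lborel. a * (u powr (a - 1) * ?e u) - z * (u powr (a + 1 - 1) * ?e u)) =
        (LINT u:{0<..}|lborel. a * (u powr (a - 1) * ?e u)) -
        (LINT u:{0<..}|lborel. z * (u powr (a + 1 - 1) * ?e u))"
      using I assms by (intro set_integral_diff set_integrable_mult_right) auto
    finally show ?thesis
      unfolding weber_integral_def by (simp only: set_integral_mult_right)
  qed
  ultimately show ?thesis by simp
qed

text \<open>The substitution \<open>u = v / x\<close> pulls out \<open>x powr (- a)\<close> and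
  turns the Gaussian factor into \<open>exp (- (v / x)^2 / 2)\<close>, which is at most 1 and tends
  to 1; the Gamma integrand dominates.\<close>

lemma weber_integral_asymptotics:
  assumes "a > 0"
  shows "((\<lambda>x. weber_integral a x * x powr a) \<longlongrightarrow> Gamma a) at_top"
proof -
  let ?s = "\<lambda>x v. indicator {0<..} v *\<^sub>R (v powr (a - 1) * exp (- v - (v / x)\<^sup>2 / 2)) :: real"
  let ?w = "\<lambda>v. indicator {0<..} v *\<^sub>R (v powr (a - 1) * exp (- v)) :: real"
  have "((\<lambda>x. \<integral>v. ?s x v \<partial>lborel) \<longlongrightarrow> (\<integral>v. ?w v \<partial>lborel)) at_top"
  proof (rule integral_dominated_convergence_at_top)
    show "integrable lborel ?w"
      using Gamma_set_integral(1)[OF assms] by (simp add: set_integrable_def)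
    have "((\<lambda>x. exp (- v - (v / x)\<^sup>2 / 2)) \<longlongrightarrow> exp (- v - 0\<^sup>2 / 2)) at_top" for v :: real
      by (intro tendsto_intros tendsto_divide_0 filterlim_at_top_imp_at_infinity filterlim_ident) auto
    then have "((\<lambda>x. exp (- v - (v / x)\<^sup>2 / 2)) \<longlongrightarrow> exp (- v)) at_top" for v :: real
      by simp
    then show "AE v in lborel. ((\<lambda>x. ?s x v) \<longlongrightarrow> ?w v) at_top"
      by (intro AE_I2 tendsto_scaleR tendsto_mult tendsto_const)
    show "\<forall>\<^sub>F x in at_top. AE v in lborel. norm (?s x v) \<le> ?w v"
      by (intro always_eventually allI AE_I2) (auto simp: indicator_def)
  qed auto
  then have "((\<lambda>x. \<integral>v. ?s x v \<partial>lborel) \<longlongrightarrow> Gamma a) at_top"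
    using Gamma_set_integral(2)[OF assms] by (simp add: set_lebesgue_integral_def)
  then show ?thesis
  proof (rule Lim_transform_eventually)
    show "\<forall>\<^sub>F x in at_top. (\<integral>v. ?s x v \<partial>lborel) = weber_integral a x * x powr a"
      using eventually_gt_at_top[of 0]
    proof eventually_elim
      case (elim x)
      define J where "J = (\<integral>v. ?s x v \<partial>lborel)"
      have "weber_integral a x = (1 / x) * (\<integral>v. indicator {0<..} (v / x) *\<^sub>R
          ((v / x) powr (a - 1) * exp (- x * (v / x) - (v / x)\<^sup>2 / 2)) \<partial>lborel)"
        unfolding weber_integral_def set_lebesgue_integral_def
        by (subst lborel_integral_real_affine[of "1 / x" _ 0]) (use elim in auto)
      also have "(\<lambda>v. indicator {0<..} (v / x) *\<^sub>R
          ((v / x) powr (a - 1) * exp (- x * (v / x) - (v / x)\<^sup>2 / 2))) = (\<lambda>v. x powr (1 - a) * ?s x v)"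
        using elim by (auto simp: fun_eq_iff indicator_def powr_divide powr_diff zero_less_divide_iff)
      also have "(1 / x) * (\<integral>v. x powr (1 - a) * ?s x v \<partial>lborel) = x powr (- a) * J"
        unfolding integral_mult_right_zero J_def[symmetric]
        using elim by (simp add: powr_diff powr_minus field_simps)
      finally show ?case
        unfolding J_def[symmetric] using elim by (simp add: powr_minus field_simps)
    qed
  qed
qed

text \<open>Expansion of \<open>exp (- z * u)\<close> under the integral. The partial sums are at
  most \<open>exp (\<bar>z\<bar> * u)\<close>, so the integrand at \<open>- \<bar>z\<bar>\<close>
  dominates; each factor \<open>u ^ n\<close> raises the parameter by n.\<close>

lemma weber_integral_sums:
  assumes "a > 0"
  shows "(\<lambda>n. ((-1) ^ n / fact n * weber_integral (a + real n) 0) * z ^ n) sums weber_integral a z"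
proof -
  let ?t = "\<lambda>n u. indicator {0<..} u *\<^sub>R (u powr (a + real n - 1) * exp (- 0 * u - u\<^sup>2 / 2)) :: real"
  let ?s = "\<lambda>N u. \<Sum>n<N. ((-1) ^ n / fact n) * z ^ n * ?t n u"
  have int: "integrable lborel (?t n)" for n
    using weber_integrable[of "a + real n" 0] assms by (simp add: set_integrable_def)
  have eq: "?s N u = indicator {0<..} u *\<^sub>R
      (u powr (a - 1) * exp (- u\<^sup>2 / 2) * (\<Sum>n<N. (- z * u) ^ n /\<^sub>R fact n))" for N u
  proof (cases "u > 0")
    case True
    have "u powr (a + real n - 1) = u powr (a - 1) * u ^ n" for n
      using True by (simp add: powr_realpow[symmetric] powr_add[symmetric] algebra_simps)
    moreover have "(- z * u) ^ n = (- 1) ^ n * z ^ n * u ^ n" for n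
      unfolding power_mult_distrib[symmetric] by simp
    ultimately show ?thesis
      using True by (simp add: sum_distrib_left sum_distrib_right field_simps)
  qed simp
  have "(\<lambda>N. \<integral>u. ?s N u \<partial>lborel) \<longlonglongrightarrow>
      (\<integral>u. indicator {0<..} u *\<^sub>R (u powr (a - 1) * exp (- z * u - u\<^sup>2 / 2)) \<partial>lborel)"
  proof (rule integral_dominated_convergence)
    show "integrable lborel (\<lambda>u. indicator {0<..} u *\<^sub>R (u powr (a - 1) * exp (- (- \<bar>z\<bar>) * u - u\<^sup>2 / 2)))"
      using weber_integrable[OF assms, of "- \<bar>z\<bar>"] by (simp add: set_integrable_def)
    show "AE u in lborel. norm (?s N u) \<le>
        indicator {0<..} u *\<^sub>R (u powr (a - 1) * exp (- (- \<bar>z\<bar>) * u - u\<^sup>2 / 2))" for N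
    proof (rule AE_I2)
      fix u :: real
      have "\<bar>\<Sum>n<N. (- z * u) ^ n /\<^sub>R fact n\<bar> \<le> exp (\<bar>z\<bar> * u)" if "u > 0"
      proof -
        have "\<bar>\<Sum>n<N. (- z * u) ^ n /\<^sub>R fact n\<bar> \<le> (\<Sum>n<N. (\<bar>z\<bar> * u) ^ n /\<^sub>R fact n)"
          using that by (intro order.trans[OF sum_abs] sum_mono) (auto simp: abs_mult power_abs)
        also have "\<dots> \<le> exp (\<bar>z\<bar> * u)"
          using that unfolding exp_def by (intro sum_le_suminf summable_exp_generic) auto
        finally show ?thesis .
      qed
      then have "u powr (a - 1) * exp (- u\<^sup>2 / 2) * \<bar>\<Sum>n<N. (- z * u) ^ n /\<^sub>R fact n\<bar> \<le>
          u powr (a - 1) * exp (- u\<^sup>2 / 2) * exp (\<bar>z\<bar> * u)" if "u > 0"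
        using that by (intro mult_left_mono) auto
      then show "norm (?s N u) \<le>
        indicator {0<..} u *\<^sub>R (u powr (a - 1) * exp (- (- \<bar>z\<bar>) * u - u\<^sup>2 / 2))"
        unfolding eq by (auto simp: indicator_def abs_mult mult.assoc exp_add[symmetric])
    qed
    show "AE u in lborel. (\<lambda>N. ?s N u) \<longlonglongrightarrow>
        indicator {0<..} u *\<^sub>R (u powr (a - 1) * exp (- z * u - u\<^sup>2 / 2))"
    proof (rule AE_I2)
      fix u :: real
      have "(\<lambda>N. \<Sum>n<N. (- z * u) ^ n /\<^sub>R fact n) \<longlonglongrightarrow> exp (- z * u)"
        using exp_converges[of "- z * u"] by (simp add: sums_def)
      then have "(\<lambda>N. ?s N u) \<longlonglongrightarrow>
          indicator {0<..} u *\<^sub>R (u powr (a - 1) * exp (- u\<^sup>2 / 2) * exp (- z * u))"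
        unfolding eq by (intro tendsto_intros)
      moreover have "exp (- u\<^sup>2 / 2) * exp (- z * u) = exp (- z * u - u\<^sup>2 / 2)"
        by (simp add: exp_add[symmetric])
      ultimately show "(\<lambda>N. ?s N u) \<longlonglongrightarrow>
          indicator {0<..} u *\<^sub>R (u powr (a - 1) * exp (- z * u - u\<^sup>2 / 2))"
        by (simp only: mult.assoc)
    qed
  qed auto
  also have "(\<lambda>N. \<integral>u. ?s N u \<partial>lborel) =
      (\<lambda>N. \<Sum>n<N. ((-1) ^ n / fact n * weber_integral (a + real n) 0) * z ^ n)"
  proof
    fix N
    have "(\<integral>u. ?s N u \<partial>lborel) = (\<Sum>n<N. \<integral>u. ((-1) ^ n / fact n) * z ^ n * ?t n u \<partial>lborel)"
      by (intro Bochner_Integration.integral_sum integrable_mult_right int)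
    also have "\<dots> = (\<Sum>n<N. ((-1) ^ n / fact n) * z ^ n * weber_integral (a + real n) 0)"
      unfolding weber_integral_def set_lebesgue_integral_def
      by (intro sum.cong refl integral_mult_right_zero)
    finally show "(\<integral>u. ?s N u \<partial>lborel) =
        (\<Sum>n<N. ((-1) ^ n / fact n * weber_integral (a + real n) 0) * z ^ n)"
      by (simp add: mult_ac)
  qed
  finally show ?thesis
    by (simp add: sums_def weber_integral_def set_lebesgue_integral_def)
qed

text \<open>The entire extension of \<open>weber_integral a\<close>, given by its Taylor series at
  0, so that complex derivatives reduce to termwise differentiation.\<close>

definition weber_entire :: "real \<Rightarrow> complex \<Rightarrow> complex" where
  "weber_entire a z = (\<Sum>n. of_real ((-1) ^ n / fact n * weber_integral (a + real n) 0) * z ^ n)"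

lemma weber_entire_summable:
  assumes "a > 0"
  shows "summable (\<lambda>n. of_real ((-1) ^ n / fact n * weber_integral (a + real n) 0) * (z::complex) ^ n)"
proof (rule powser_inside)
  let ?c = "\<lambda>n. (-1) ^ n / fact n * weber_integral (a + real n) 0"
  have "summable (\<lambda>n. ?c n * (norm z + 1) ^ n)"
    using weber_integral_sums[OF assms] by (rule sums_summable)
  then have "summable (\<lambda>n. complex_of_real (?c n * (norm z + 1) ^ n))"
    by (rule summable_of_real)
  then show "summable (\<lambda>n. of_real (?c n) * (complex_of_real (norm z + 1)) ^ n)"
    by simp
  show "norm z < norm (complex_of_real (norm z + 1))"
    by (simp del: of_real_add)
qed

lemma weber_entire_of_real:
  assumes "a > 0"
  shows "weber_entire a (of_real x) = of_real (weber_integral a x)"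
proof -
  have "(\<lambda>n. complex_of_real (((-1) ^ n / fact n * weber_integral (a + real n) 0) * x ^ n)) sums
      of_real (weber_integral a x)"
    using weber_integral_sums[OF assms, of x] by (simp only: sums_of_real_iff)
  then show ?thesis
    unfolding weber_entire_def by (simp add: sums_iff)
qed

lemma weber_entire_has_field_derivative:
  assumes "a > 0"
  shows "(weber_entire a has_field_derivative - weber_entire (a + 1) z) (at z)"
proof -
  let ?c = "\<lambda>a n. complex_of_real ((-1) ^ n / fact n * weber_integral (a + real n) 0)"
  have diffs: "diffs (?c a) = (\<lambda>n. - ?c (a + 1) n)"
  proof
    fix n
    have "a + real (Suc n) = a + 1 + real n" by simp
    then show "diffs (?c a) n = - ?c (a + 1) n"
      by (simp add: diffs_def divide_simps del: of_nat_Suc) (simp add: algebra_simps)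
  qed
  have "((\<lambda>z. \<Sum>n. ?c a n * z ^ n) has_field_derivative (\<Sum>n. diffs (?c a) n * z ^ n)) (at z)"
    by (intro termdiffs_strong_converges_everywhere weber_entire_summable assms)
  also have "(\<Sum>n. diffs (?c a) n * z ^ n) = (\<Sum>n. - (?c (a + 1) n * z ^ n))"
    unfolding diffs by simp
  also have "\<dots> = - weber_entire (a + 1) z"
    unfolding weber_entire_def using assms by (intro suminf_minus weber_entire_summable) auto
  finally show ?thesis by (simp only: weber_entire_def[abs_def])
qed

lemma weber_entire_holomorphic: "a > 0 \<Longrightarrow> weber_entire a holomorphic_on UNIV"
  by (meson weber_entire_has_field_derivative field_differentiable_def holomorphic_on_def
      field_differentiable_at_within)

text \<open>Both sides are entire and agree on the real axis by integration by parts.\<close>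

lemma weber_entire_recurrence:
  assumes "a > 0"
  shows "of_real a * weber_entire a z = z * weber_entire (a + 1) z + weber_entire (a + 2) z"
proof -
  have "(\<lambda>z. of_real a * weber_entire a z) = (\<lambda>z. z * weber_entire (a + 1) z + weber_entire (a + 2) z)"
  proof (rule entire_eqI_of_eventually_real)
    show "eventually (\<lambda>x::real. of_real a * weber_entire a (of_real x) =
        of_real x * weber_entire (a + 1) (of_real x) + weber_entire (a + 2) (of_real x)) at_top"
      using assms weber_integral_recurrence[OF assms]
      by (intro always_eventually allI)
        (simp add: weber_entire_of_real del: of_real_mult of_real_add add: of_real_mult[symmetric]
          of_real_add[symmetric])
  qed (use assms in \<open>auto intro!: holomorphic_intros weber_entire_holomorphic\<close>)
  then show ?thesis by metis
qed

text \<open>For p < 0 this is \<open>exp (- z^2 / 4)\<close> times the classical integral for the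
  function of order p, whose own prefactor supplies the other half of
  \<open>exp (- z^2 / 2)\<close>.\<close>

definition gauss_weber :: "real \<Rightarrow> complex \<Rightarrow> complex" where
  "gauss_weber p z = exp (- z\<^sup>2 / 2) * weber_entire (- p) z / of_real (Gamma (- p))"

lemma gauss_weber_of_real:
  assumes "p < 0"
  shows "gauss_weber p (of_real x) = of_real (exp (- x\<^sup>2 / 2) * weber_integral (- p) x / Gamma (- p))"
proof -
  have "exp (- (of_real x :: complex)\<^sup>2 / 2) = of_real (exp (- x\<^sup>2 / 2))"
    by (simp add: exp_of_real[symmetric])
  then show ?thesis
    using assms by (simp add: gauss_weber_def weber_entire_of_real)
qed

lemma deriv_gauss_weber:
  assumes "p < 0"
  shows "deriv (gauss_weber p) = (\<lambda>z. - exp (- z\<^sup>2 / 2) *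
      (z * weber_entire (- p) z + weber_entire (1 - p) z) / of_real (Gamma (- p)))"
proof (intro ext DERIV_imp_deriv)
  fix z
  have [derivative_intros]: "(weber_entire (- p) has_field_derivative - weber_entire (1 - p) z) (at z)" for z
    using weber_entire_has_field_derivative[of "- p"] assms by simp
  show "(gauss_weber p has_field_derivative - exp (- z\<^sup>2 / 2) *
      (z * weber_entire (- p) z + weber_entire (1 - p) z) / of_real (Gamma (- p))) (at z)"
    unfolding gauss_weber_def[abs_def]
    by (rule DERIV_cdivide) (auto intro!: derivative_eq_intros simp: algebra_simps)
qed

text \<open>For p < -1 both orders are still negative. The recurrence with parameter -p - 1
  collapses the bracket in the derivative to one integral, and
  \<open>Gamma (- p) = (- p - 1) * Gamma (- p - 1)\<close> adjusts the normalisation.\<close>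

lemma deriv_gauss_weber_shift:
  assumes "p < -1"
  shows "deriv (gauss_weber p) z = - gauss_weber (p + 1) z"
proof -
  have "z * weber_entire (- p) z + weber_entire (1 - p) z = of_real (- p - 1) * weber_entire (- p - 1) z"
    using weber_entire_recurrence[of "- p - 1" z] assms by simp
  moreover have "Gamma (- p) = (- p - 1) * Gamma (- p - 1)"
    using Gamma_plus1[of "- p - 1"] assms by (auto simp: nonpos_Ints_def)
  moreover have "- (p + 1) = - p - 1" by simp
  ultimately show ?thesis
    using assms unfolding deriv_gauss_weber[OF order.strict_trans[OF assms, of 0, simplified]] gauss_weber_def
    by (simp del: of_real_diff of_real_minus of_real_add)
qed

text \<open>Two differentiations bring in the parameters -p, 1 - p and 2 - p; the recurrence
  eliminates the last and leaves the differential equation.\<close>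

lemma gauss_cylinder_gauss_weber:
  assumes "p < 0"
  shows "gauss_cylinder p (gauss_weber p)"
  unfolding gauss_cylinder_def
proof (intro conjI allI)
  have G: "Gamma (- p) > 0" using assms by simp
  show "gauss_weber p holomorphic_on UNIV"
    unfolding gauss_weber_def[abs_def] using assms G
    by (intro holomorphic_intros weber_entire_holomorphic) auto
  fix z
  have [derivative_intros]: "(weber_entire (- p) has_field_derivative - weber_entire (1 - p) z) (at z)"
      "(weber_entire (1 - p) has_field_derivative - weber_entire (2 - p) z) (at z)" for z
    using weber_entire_has_field_derivative[of "- p"] weber_entire_has_field_derivative[of "1 - p"]
      assms by (simp_all add: algebra_simps)
  let ?k = "complex_of_real (Gamma (- p))"
  have "deriv (deriv (gauss_weber p)) z = exp (- z\<^sup>2 / 2) *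
      (z * (z * weber_entire (- p) z + weber_entire (1 - p) z) - weber_entire (- p) z
       + z * weber_entire (1 - p) z + weber_entire (2 - p) z) / ?k"
    unfolding deriv_gauss_weber[OF assms]
    by (rule DERIV_imp_deriv, rule DERIV_cdivide)
      (auto intro!: derivative_eq_intros simp: algebra_simps)
  also have "weber_entire (2 - p) z = - of_real p * weber_entire (- p) z - z * weber_entire (1 - p) z"
    using weber_entire_recurrence[of "- p" z] assms by (simp add: algebra_simps)
  finally have dd: "deriv (deriv (gauss_weber p)) z = exp (- z\<^sup>2 / 2) *
      (z * (z * weber_entire (- p) z + weber_entire (1 - p) z) - weber_entire (- p) z
       + z * weber_entire (1 - p) z + (- of_real p * weber_entire (- p) z - z * weber_entire (1 - p) z)) / ?k" .
  show "deriv (deriv (gauss_weber p)) z + z * deriv (gauss_weber p) z +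
      of_real (p + 1) * gauss_weber p z = 0"
    unfolding dd unfolding deriv_gauss_weber[OF assms] gauss_weber_def using G
    by (simp add: divide_simps) (simp add: algebra_simps)
next
  have G: "Gamma (- p) > 0" using assms by simp
  have "((\<lambda>x. weber_integral (- p) x * x powr (- p) / Gamma (- p)) \<longlongrightarrow> Gamma (- p) / Gamma (- p)) at_top"
    using assms less_imp_neq[OF G, symmetric]
    by (intro tendsto_divide weber_integral_asymptotics tendsto_const) simp
  then have "((\<lambda>x. complex_of_real (weber_integral (- p) x * x powr (- p) / Gamma (- p))) \<longlongrightarrow> of_real 1) at_top"
    using G by (intro tendsto_of_real) simp
  then have "((\<lambda>x. complex_of_real (weber_integral (- p) x * x powr (- p) / Gamma (- p))) \<longlongrightarrow> 1) at_top"
    by simp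
  then show "((\<lambda>x::real. gauss_weber p (of_real x) / of_real (x powr p * exp (- x\<^sup>2 / 2))) \<longlongrightarrow> 1) at_top"
  proof (rule Lim_transform_eventually)
    show "\<forall>\<^sub>F x in at_top. complex_of_real (weber_integral (- p) x * x powr (- p) / Gamma (- p)) =
        gauss_weber p (of_real x) / of_real (x powr p * exp (- x\<^sup>2 / 2))"
      unfolding gauss_weber_of_real[OF assms] of_real_divide[symmetric]
      by (intro always_eventually allI) (simp add: powr_minus field_simps)
  qed
qed

text \<open>Each differentiation of the equation raises its constant by 1. For the normalisation,
  \<open>g'' = - x * g' - (p + 1) * g\<close>: the assumption on - g' makes the first term
  asymptotic to \<open>x powr (p + 2) * exp (- x^2 / 2)\<close>, and the second is smaller by a
  factor of order \<open>1 / x^2\<close>.\<close>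

lemma gauss_cylinder_shift:
  assumes g: "gauss_cylinder p g" and g': "gauss_cylinder (p + 1) (\<lambda>z. - deriv g z)"
  shows "gauss_cylinder (p + 2) (deriv (deriv g))"
  unfolding gauss_cylinder_def
proof (intro conjI allI)
  have hol: "g holomorphic_on UNIV" "deriv g holomorphic_on UNIV"
      "deriv (deriv g) holomorphic_on UNIV"
    using g by (auto simp: gauss_cylinder_def intro!: deriv_holomorphic_UNIV)
  then show "deriv (deriv g) holomorphic_on UNIV" by simp
  note D[derivative_intros] = hol[THEN holomorphic_UNIV_has_deriv]
  have ode: "deriv (deriv g) = (\<lambda>z. - z * deriv g z - of_real (p + 1) * g z)"
    using gauss_cylinder_ode[OF g] by auto
  have ode1: "deriv (deriv (deriv g)) = (\<lambda>z. - z * deriv (deriv g) z - of_real (p + 2) * deriv g z)"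
  proof
    fix z
    have "((\<lambda>z. - z * deriv g z - of_real (p + 1) * g z) has_field_derivative
        - z * deriv (deriv g) z - of_real (p + 2) * deriv g z) (at z)"
      by (auto intro!: derivative_eq_intros simp: algebra_simps)
    then show "deriv (deriv (deriv g)) z = - z * deriv (deriv g) z - of_real (p + 2) * deriv g z"
      unfolding ode[symmetric] by (rule DERIV_imp_deriv)
  qed
  fix z
  have "((\<lambda>z. - z * deriv (deriv g) z - of_real (p + 2) * deriv g z) has_field_derivative
      - z * deriv (deriv (deriv g)) z - of_real (p + 3) * deriv (deriv g) z) (at z)"
    by (auto intro!: derivative_eq_intros simp: algebra_simps)
  then have "deriv (deriv (deriv (deriv g))) z =
      - z * deriv (deriv (deriv g)) z - of_real (p + 3) * deriv (deriv g) z"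
    unfolding ode1[symmetric] by (rule DERIV_imp_deriv)
  then show "deriv (deriv (deriv (deriv g))) z + z * deriv (deriv (deriv g)) z +
      of_real (p + 2 + 1) * deriv (deriv g) z = 0"
    by simp
next
  let ?q = "\<lambda>p x. complex_of_real (x powr p * exp (- x\<^sup>2 / 2))"
  have 1: "((\<lambda>x::real. g (of_real x) / ?q p x) \<longlongrightarrow> 1) at_top"
    using g by (simp add: gauss_cylinder_def)
  have 2: "((\<lambda>x::real. - deriv g (of_real x) / ?q (p + 1) x) \<longlongrightarrow> 1) at_top"
    using g' by (simp add: gauss_cylinder_def)
  have "((\<lambda>x::real. 1 / x\<^sup>2) \<longlongrightarrow> 0) at_top" by real_asymp
  then have 3: "((\<lambda>x::real. of_real (1 / x\<^sup>2) :: complex) \<longlongrightarrow> of_real 0) at_top"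
    by (rule tendsto_of_real)
  have "((\<lambda>x::real. - deriv g (of_real x) / ?q (p + 1) x -
      of_real (p + 1) * (g (of_real x) / ?q p x) * of_real (1 / x\<^sup>2)) \<longlongrightarrow>
      1 - of_real (p + 1) * 1 * of_real 0) at_top"
    by (intro tendsto_diff tendsto_mult tendsto_const 1 2 3)
  then have "((\<lambda>x::real. - deriv g (of_real x) / ?q (p + 1) x -
      of_real (p + 1) * (g (of_real x) / ?q p x) * of_real (1 / x\<^sup>2)) \<longlongrightarrow> 1) at_top"
    by simp
  then show "((\<lambda>x::real. deriv (deriv g) (of_real x) / ?q (p + 2) x) \<longlongrightarrow> 1) at_top"
  proof (rule Lim_transform_eventually)
    show "\<forall>\<^sub>F x in at_top. - deriv g (of_real x) / ?q (p + 1) x -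
      of_real (p + 1) * (g (of_real x) / ?q p x) * of_real (1 / x\<^sup>2) =
      deriv (deriv g) (of_real x) / ?q (p + 2) x"
      using eventually_gt_at_top[of 0]
    proof eventually_elim
      case (elim x)
      have "?q (p + 1) x = of_real x * ?q p x" "?q (p + 2) x = of_real (x\<^sup>2) * ?q p x"
        using elim by (simp_all add: powr_add mult_ac)
      moreover have "?q p x \<noteq> 0" using elim by simp
      ultimately show ?case
        using elim unfolding gauss_cylinder_ode[OF g]
        by (simp add: divide_simps power2_eq_square del: of_real_mult of_real_add)
           (simp add: algebra_simps)
    qed
  qed
qed

text \<open>The induction starts with p < -1, where the integral serves both p and p + 1. From g at
  order p - 1 the next pair is - g' and g'', so the second conjunct is what makes the induction
  close.\<close>

lemma gauss_cylinder_exists: "\<exists>g. gauss_cylinder p g \<and> gauss_cylinder (p + 1) (\<lambda>z. - deriv g z)"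
proof -
  have "\<exists>g. gauss_cylinder p g \<and> gauss_cylinder (p + 1) (\<lambda>z. - deriv g z)" if "p < real n - 1" for n p
    using that
  proof (induction n arbitrary: p)
    case 0
    then have "(\<lambda>z. - deriv (gauss_weber p) z) = gauss_weber (p + 1)"
      by (simp add: deriv_gauss_weber_shift)
    then have "gauss_cylinder p (gauss_weber p)" "gauss_cylinder (p + 1) (\<lambda>z. - deriv (gauss_weber p) z)"
      using gauss_cylinder_gauss_weber[of p] gauss_cylinder_gauss_weber[of "p + 1"] 0 by simp_all
    then show ?case by blast
  next
    case (Suc n)
    then obtain g where g: "gauss_cylinder (p - 1) g" "gauss_cylinder p (\<lambda>z. - deriv g z)"
      by (force dest: Suc.IH[of "p - 1"])
    have "deriv (\<lambda>z. - deriv g z) = (\<lambda>z. - deriv (deriv g) z)"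
      using g(1) by (intro ext deriv_minus)
        (auto simp: gauss_cylinder_def intro!: holomorphic_on_imp_differentiable_at[of _ UNIV] deriv_holomorphic_UNIV)
    moreover have "gauss_cylinder (p + 1) (deriv (deriv g))"
      using gauss_cylinder_shift[of "p - 1" g] g by (simp add: add.commute)
    ultimately show ?case using g(2) by (intro exI[of _ "\<lambda>z. - deriv g z"]) simp
  qed
  moreover obtain n :: nat where "p + 1 < real n" using reals_Archimedean2 by blast
  ultimately show ?thesis by (auto simp: less_diff_eq)
qed

lemma parabolic_cylinder_eq:
  assumes "gauss_cylinder p g"
  shows "exp (- z\<^sup>2 / 4) * parabolic_cylinder p z = g z"
proof -
  let ?u = "\<lambda>z. exp (z\<^sup>2 / 4) * g z"
  have e: "exp (- z\<^sup>2 / 4) * exp (z\<^sup>2 / 4) = 1" for z :: complex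
    by (simp add: exp_add[symmetric])
  have "(\<lambda>z. exp (- z\<^sup>2 / 4) * ?u z) = g"
    by (simp only: mult.assoc[symmetric] e) simp
  then have u: "is_parabolic_cylinder p ?u"
    using assms by (simp only: is_parabolic_cylinder_iff_gauss_cylinder)
  have "parabolic_cylinder p = ?u"
    unfolding parabolic_cylinder_def
  proof (rule the_equality[of "is_parabolic_cylinder p", OF u])
    fix v assume "is_parabolic_cylinder p v"
    then have "g = (\<lambda>z. exp (- z\<^sup>2 / 4) * v z)"
      using assms gauss_cylinder_unique by (simp only: is_parabolic_cylinder_iff_gauss_cylinder) 
    then show "v = ?u"
      by (simp add: fun_eq_iff mult.assoc[symmetric] exp_add[symmetric])
  qed
  then show ?thesis by (simp only: mult.assoc[symmetric] e) simp
qed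

section \<open>The transformed function on the real axis\<close>

definition gauss_pcf :: "real \<Rightarrow> real \<Rightarrow> real" where
  "gauss_pcf p x = exp (- x\<^sup>2 / 4) * parabolic_cylinder_real p x"

lemma gauss_pcf_eq:
  assumes "gauss_cylinder p g"
  shows "gauss_pcf p x = Re (g (of_real x))"
proof -
  have "exp (- (of_real x :: complex)\<^sup>2 / 4) = of_real (exp (- x\<^sup>2 / 4))"
    by (simp add: exp_of_real[symmetric])
  then show ?thesis
    unfolding parabolic_cylinder_eq[OF assms, symmetric]
    by (simp add: gauss_pcf_def parabolic_cylinder_real_def)
qed

lemma gauss_pcf_has_real_derivative:
  "(gauss_pcf p has_real_derivative - gauss_pcf (p + 1) x) (at x)"
proof -
  obtain g where g: "gauss_cylinder p g" "gauss_cylinder (p + 1) (\<lambda>z. - deriv g z)"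
    using gauss_cylinder_exists by blast
  have "((\<lambda>x. Re (g (of_real x))) has_real_derivative Re (deriv g (of_real x))) (at x)"
    using g(1) by (intro has_field_derivative_Re of_real_deriv) (simp add: gauss_cylinder_def)
  then show ?thesis
    by (simp add: gauss_pcf_eq[OF g(1), abs_def] gauss_pcf_eq[OF g(2)])
qed

lemma gauss_pcf_recurrence:
  "gauss_pcf (p + 2) x = x * gauss_pcf (p + 1) x - (p + 1) * gauss_pcf p x"
proof -
  obtain g where g: "gauss_cylinder p g" "gauss_cylinder (p + 1) (\<lambda>z. - deriv g z)"
    using gauss_cylinder_exists by blast
  note 2 = gauss_cylinder_shift[OF g]
  show ?thesis
    by (simp add: gauss_pcf_eq[OF g(1)] gauss_pcf_eq[OF g(2)] gauss_pcf_eq[OF 2] gauss_cylinder_ode[OF g(1)]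
        del: of_real_add)
qed

lemma gauss_pcf_asymptotics:
  "((\<lambda>x. gauss_pcf p x / (x powr p * exp (- x\<^sup>2 / 2))) \<longlongrightarrow> 1) at_top"
proof -
  obtain g where g: "gauss_cylinder p g" using gauss_cylinder_exists by blast
  then have "((\<lambda>x::real. Re (g (of_real x) / of_real (x powr p * exp (- x\<^sup>2 / 2)))) \<longlongrightarrow> Re 1) at_top"
    by (intro tendsto_Re) (simp add: gauss_cylinder_def)
  then show ?thesis
    by (simp only: Re_divide_of_real gauss_pcf_eq[OF g]) simp
qed

lemma gauss_pcf_0: "gauss_pcf 0 x = exp (- x\<^sup>2 / 2)"
proof -
  let ?e = "\<lambda>z::complex. exp (- z\<^sup>2 / 2)"
  have e: "?e (of_real x) = of_real (exp (- x\<^sup>2 / 2))" for x :: real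
    by (simp add: exp_of_real[symmetric])
  have d: "deriv ?e = (\<lambda>z. - z * ?e z)"
    by (intro ext DERIV_imp_deriv) (auto intro!: derivative_eq_intros)
  have dd: "deriv (\<lambda>z. - z * ?e z) z = - ?e z + z\<^sup>2 * ?e z" for z
    by (rule DERIV_imp_deriv) (auto intro!: derivative_eq_intros simp: power2_eq_square)
  have "gauss_cylinder 0 ?e"
    unfolding gauss_cylinder_def d dd
  proof (intro conjI allI)
    show "((\<lambda>x::real. ?e (of_real x) / of_real (x powr 0 * exp (- x\<^sup>2 / 2))) \<longlongrightarrow> 1) at_top"
    proof (rule tendsto_eventually)
      show "\<forall>\<^sub>F x::real in at_top. ?e (of_real x) / of_real (x powr 0 * exp (- x\<^sup>2 / 2)) = 1"
        using eventually_gt_at_top[of 0] by eventually_elim (simp only: e, simp)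
    qed
  qed (auto intro!: holomorphic_intros simp: power2_eq_square)
  then show ?thesis
    using gauss_pcf_eq[of 0 ?e x] by (simp only: e) simp
qed

text \<open>Completing the square absorbs \<open>exp (- x^2 / 2)\<close> into the integrand. This
  exhibits \<open>gauss_pcf p\<close> as a mixture of translates of the Gaussian, with weight
  \<open>u powr (- p - 1) / Gamma (- p)\<close>.\<close>

lemma gauss_pcf_neg:
  assumes "p < 0"
  shows "gauss_pcf p x = (LINT u:{0<..}|lborel. u powr (- p - 1) * exp (- (x + u)\<^sup>2 / 2)) / Gamma (- p)"
proof -
  have "exp (- x\<^sup>2 / 2) * weber_integral (- p) x =
      (LINT u:{0<..}|lborel. exp (- x\<^sup>2 / 2) * (u powr (- p - 1) * exp (- x * u - u\<^sup>2 / 2)))"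
    unfolding weber_integral_def by (simp only: set_integral_mult_right)
  also have "\<dots> = (LINT u:{0<..}|lborel. u powr (- p - 1) * exp (- (x + u)\<^sup>2 / 2))"
    by (intro set_lebesgue_integral_cong)
      (auto simp: mult.left_commute exp_add[symmetric] field_simps power2_eq_square)
  finally show ?thesis
    using gauss_pcf_eq[OF gauss_cylinder_gauss_weber[OF assms], of x]
    unfolding gauss_weber_of_real[OF assms] by simp
qed

lemma gauss_pcf_continuous_on: "continuous_on A (gauss_pcf p)"
  by (meson DERIV_continuous_on DERIV_subset gauss_pcf_has_real_derivative subset_UNIV has_field_derivative_at_within)

lemma gauss_pcf_measurable [measurable]: "gauss_pcf p \<in> borel_measurable borel"
  by (rule borel_measurable_continuous_onI) (rule gauss_pcf_continuous_on)

text \<open>The energy \<open>g'\<^sup>2 + (p + 1) * g\<^sup>2\<close> has derivative \<open>- 2 * x * g'\<^sup>2\<close>, so it is maximal at \<open>0\<close>.\<close>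

lemma gauss_pcf_bounded:
  assumes "p > -1"
  obtains C where "\<And>x. \<bar>gauss_pcf p x\<bar> \<le> C"
proof -
  define E where "E = (\<lambda>x. (gauss_pcf (p + 1) x)\<^sup>2 + (p + 1) * (gauss_pcf p x)\<^sup>2)"
  note [derivative_intros] = gauss_pcf_has_real_derivative
  have E': "(E has_real_derivative - 2 * x * (gauss_pcf (p + 1) x)\<^sup>2) (at x)" for x
  proof -
    \<comment> \<open>The recurrence for order p + 2 cancels the mixed terms
      \<open>gauss_pcf p x * gauss_pcf (p + 1) x\<close>.\<close>
    have "p + 1 + 1 = p + 2" by simp
    then have "- 2 * x * (gauss_pcf (p + 1) x)\<^sup>2 = 2 * gauss_pcf (p + 1) x * - gauss_pcf (p + 1 + 1) x +
        (p + 1) * (2 * gauss_pcf p x * - gauss_pcf (p + 1) x)"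
      unfolding \<open>p + 1 + 1 = p + 2\<close> gauss_pcf_recurrence by (simp add: power2_eq_square algebra_simps)
    then show ?thesis
      unfolding E_def by (auto intro!: derivative_eq_intros)
  qed
  have "E x \<le> E 0" for x
  proof (cases "x \<ge> 0")
    case True
    show ?thesis
      by (rule DERIV_nonpos_imp_nonincreasing[OF True]) (use E' in \<open>fastforce simp: mult_nonneg_nonneg\<close>)
  next
    case False
    then have "x \<le> 0" by simp
    then show ?thesis
      by (rule DERIV_nonneg_imp_nondecreasing) (use E' in \<open>fastforce simp: mult_nonpos_nonneg\<close>)
  qed
  then have "(p + 1) * (gauss_pcf p x)\<^sup>2 \<le> E 0" for x
    unfolding E_def by (smt (verit) zero_le_power2)
  then have "(gauss_pcf p x)\<^sup>2 \<le> E 0 / (p + 1)" for x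
    using assms by (simp add: field_simps)
  then have "\<bar>gauss_pcf p x\<bar> \<le> sqrt (E 0 / (p + 1))" for x
    by (metis real_le_rsqrt power2_abs)
  then show ?thesis using that by blast
qed

text \<open>For large x the Gaussian asymptotics beat every power; elsewhere boundedness suffices.
  The exponent p + 1 is the one that will cancel the singular factor
  \<open>r powr (- ((p + 1) / 2))\<close> of the rescaled kernel.\<close>

lemma gauss_pcf_decay:
  assumes "p > -1"
  obtains C where "\<And>x. x > 0 \<Longrightarrow> \<bar>gauss_pcf p x\<bar> * x powr (p + 1) \<le> C"
proof -
  obtain C where C: "\<And>x. \<bar>gauss_pcf p x\<bar> \<le> C" using gauss_pcf_bounded[OF assms] by blast
  have "((\<lambda>x::real. x powr (p + (p + 1)) * exp (- x\<^sup>2 / 2)) \<longlongrightarrow> 0) at_top" by real_asymp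
  from tendsto_mult[OF gauss_pcf_asymptotics this]
  have "((\<lambda>x. gauss_pcf p x / (x powr p * exp (- x\<^sup>2 / 2)) * (x powr (p + (p + 1)) * exp (- x\<^sup>2 / 2))) \<longlongrightarrow> 0) at_top"
    by simp
  then have "((\<lambda>x. gauss_pcf p x * x powr (p + 1)) \<longlongrightarrow> 0) at_top"
  proof (rule Lim_transform_eventually)
    show "\<forall>\<^sub>F x in at_top. gauss_pcf p x / (x powr p * exp (- x\<^sup>2 / 2)) *
        (x powr (p + (p + 1)) * exp (- x\<^sup>2 / 2)) = gauss_pcf p x * x powr (p + 1)"
      using eventually_gt_at_top[of 0] by eventually_elim (simp only: powr_add[of _ p "p + 1"], simp)
  qed
  from tendstoD[OF this, of 1] have "\<forall>\<^sub>F x in at_top. \<bar>gauss_pcf p x\<bar> * x powr (p + 1) < 1"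
    by (simp add: abs_mult)
  then obtain X where X: "\<And>x. x \<ge> X \<Longrightarrow> \<bar>gauss_pcf p x\<bar> * x powr (p + 1) < 1"
    by (auto simp: eventually_at_top_linorder)
  have "\<bar>gauss_pcf p x\<bar> * x powr (p + 1) \<le> max 1 (C * \<bar>X\<bar> powr (p + 1))" if "x > 0" for x
  proof (cases "x \<ge> X")
    case True
    then show ?thesis using X[of x] by simp
  next
    case False
    then have "x powr (p + 1) \<le> \<bar>X\<bar> powr (p + 1)"
      using that assms by (intro powr_mono2) auto
    then have "\<bar>gauss_pcf p x\<bar> * x powr (p + 1) \<le> C * \<bar>X\<bar> powr (p + 1)"
      using C[of x] by (intro mult_mono) auto
    then show ?thesis by simp
  qed
  then show ?thesis using that by blast
qed

section \<open>Independence of past hitting events and increments\<close>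

text \<open>Continuity of the measure on both sides. Together with the decreasing version this
  carries independence from finite time grids to hitting events.\<close>

lemma (in prob_space) prob_Int_UN_incseq:
  assumes "incseq A" "\<And>n::nat. A n \<in> events" "B \<in> events"
    and "\<And>n. prob (A n \<inter> B) = prob (A n) * prob B"
  shows "prob ((\<Union>n. A n) \<inter> B) = prob (\<Union>n. A n) * prob B"
proof (rule LIMSEQ_unique)
  have "(\<lambda>n. prob (A n \<inter> B)) \<longlonglongrightarrow> prob (\<Union>n. A n \<inter> B)"
    using assms(1-3) by (intro finite_Lim_measure_incseq) (auto simp: incseq_def)
  then show "(\<lambda>n. prob (A n \<inter> B)) \<longlonglongrightarrow> prob ((\<Union>n. A n) \<inter> B)" by simp
  show "(\<lambda>n. prob (A n \<inter> B)) \<longlonglongrightarrow> prob (\<Union>n. A n) * prob B"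
    unfolding assms(4) using assms(1,2) by (intro tendsto_intros finite_Lim_measure_incseq) auto
qed

lemma (in prob_space) prob_Int_INT_decseq:
  assumes "decseq A" "\<And>n::nat. A n \<in> events" "B \<in> events"
    and "\<And>n. prob (A n \<inter> B) = prob (A n) * prob B"
  shows "prob ((\<Inter>n. A n) \<inter> B) = prob (\<Inter>n. A n) * prob B"
proof (rule LIMSEQ_unique)
  have "(\<lambda>n. prob (A n \<inter> B)) \<longlonglongrightarrow> prob (\<Inter>n. A n \<inter> B)"
    using assms(1-3) by (intro finite_Lim_measure_decseq) (auto simp: decseq_def)
  then show "(\<lambda>n. prob (A n \<inter> B)) \<longlonglongrightarrow> prob ((\<Inter>n. A n) \<inter> B)" by simp
  show "(\<lambda>n. prob (A n \<inter> B)) \<longlonglongrightarrow> prob (\<Inter>n. A n) * prob B"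
    unfolding assms(4) using assms(1,2) by (intro tendsto_intros finite_Lim_measure_decseq) auto
qed

context standard_brownian_motion
begin

text \<open>Since W starts at 0, the grid values are partial sums of the first N increments, and
  these are jointly independent of the increment from s to t.\<close>

lemma prob_grid_Int_increment:
  assumes "0 < u" "u \<le> s" "s < t" "0 < N" "K \<subseteq> {..N}"
  shows "prob ({\<omega>\<in>space M. \<exists>k\<in>K. W (real k * u / real N) \<omega> < c k} \<inter>
      {\<omega>\<in>space M. W t \<omega> - W s \<omega> \<le> d}) =
    prob {\<omega>\<in>space M. \<exists>k\<in>K. W (real k * u / real N) \<omega> < c k} *
      prob {\<omega>\<in>space M. W t \<omega> - W s \<omega> \<le> d}"
proof -
  \<comment> \<open>The partition is 0, u/N, ..., u, s, t. Increments with index below N build the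
    grid values, index N bridges u to s, possibly with zero length, and index N + 1 runs from s to
    t.\<close>
  define r where "r = (\<lambda>i. if i \<le> N then real i * u / real N else if i = N + 1 then s else t)"
  define X where "X = (\<lambda>i \<omega>. W (r (Suc i)) \<omega> - W (r i) \<omega>)"
  have mono: "r i \<le> r (Suc i)" if i: "i < N + 2" for i
  proof -
    consider "Suc i \<le> N" | "i = N" | "i = N + 1" using i by linarith
    then show ?thesis
    proof cases
      case 1
      then show ?thesis using assms by (simp add: r_def divide_right_mono)
    qed (use assms in \<open>auto simp: r_def\<close>)
  qed
  have "indep_vars (\<lambda>_. borel) X {..<N + 2}"
    unfolding X_def using mono by (intro independent_increments) (auto simp: r_def)
  then have ind: "indep_var (PiM {..<N} (\<lambda>_. borel)) (\<lambda>\<omega>. restrict (\<lambda>i. X i \<omega>) {..<N})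
      (PiM {N + 1} (\<lambda>_. borel)) (\<lambda>\<omega>. restrict (\<lambda>i. X i \<omega>) {N + 1})"
    by (rule indep_var_restrict) auto
  let ?PA = "PiM {..<N} (\<lambda>_. borel :: real measure)" and ?PB = "PiM {N + 1} (\<lambda>_. borel :: real measure)"
  define SA where "SA = {x \<in> space ?PA. \<exists>k\<in>K. (\<Sum>i<k. x i) < c k}"
  define SB where "SB = {x \<in> space ?PB. x (N + 1) \<le> d}"
  have fK: "finite K" using assms(5) finite_subset by blast
  have SA: "SA \<in> sets ?PA"
  proof -
    have [measurable]: "(\<lambda>x. \<Sum>i<k. x i) \<in> borel_measurable ?PA" if "k \<in> K" for k
    proof (rule borel_measurable_sum)
      fix i assume "i \<in> {..<k}"
      then have "i \<in> {..<N}" using that assms(5) by auto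
      then show "(\<lambda>x. x i) \<in> borel_measurable ?PA" by (rule measurable_component_singleton)
    qed
    have "SA = (\<Union>k\<in>K. {x \<in> space ?PA. (\<Sum>i<k. x i) < c k})" by (auto simp: SA_def)
    also have "\<dots> \<in> sets ?PA"
      using fK by (intro sets.finite_UN) auto
    finally show ?thesis .
  qed
  have SB: "SB \<in> sets ?PB" unfolding SB_def by measurable
  have tel: "(\<Sum>i<k. X i \<omega>) = W (real k * u / real N) \<omega>" if "\<omega> \<in> space M" "k \<le> N" for \<omega> k
    using sum_lessThan_telescope[of "\<lambda>i. W (r i) \<omega>" k] start_zero[OF that(1)] that(2)
    by (simp add: X_def r_def)
  have A: "(\<lambda>\<omega>. restrict (\<lambda>i. X i \<omega>) {..<N}) -` SA \<inter> space M =
      {\<omega>\<in>space M. \<exists>k\<in>K. W (real k * u / real N) \<omega> < c k}"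
  proof -
    have "(\<Sum>i<k. restrict (\<lambda>i. X i \<omega>) {..<N} i) = W (real k * u / real N) \<omega>"
      if "\<omega> \<in> space M" "k \<in> K" for \<omega> k
    proof -
      have "k \<le> N" using that assms(5) by auto
      then have "(\<Sum>i<k. restrict (\<lambda>i. X i \<omega>) {..<N} i) = (\<Sum>i<k. X i \<omega>)"
        by (intro sum.cong) auto
      with tel that \<open>k \<le> N\<close> show ?thesis by simp
    qed
    then show ?thesis unfolding SA_def by (auto simp: space_PiM)
  qed
  have B: "(\<lambda>\<omega>. restrict (\<lambda>i. X i \<omega>) {N + 1}) -` SB \<inter> space M = {\<omega>\<in>space M. W t \<omega> - W s \<omega> \<le> d}"
    unfolding SB_def by (auto simp: space_PiM X_def r_def)
  have "(\<lambda>\<omega>. (restrict (\<lambda>i. X i \<omega>) {..<N}, restrict (\<lambda>i. X i \<omega>) {N + 1})) -` (SA \<times> SB) \<inter> space M =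
      ((\<lambda>\<omega>. restrict (\<lambda>i. X i \<omega>) {..<N}) -` SA \<inter> space M) \<inter>
      ((\<lambda>\<omega>. restrict (\<lambda>i. X i \<omega>) {N + 1}) -` SB \<inter> space M)" by auto
  then show ?thesis
    using indep_varD[OF ind SA SB] by (simp only: A B)
qed

lemma isCont_path:
  assumes "\<omega> \<in> space M" "0 < u"
  shows "isCont (\<lambda>u. W u \<omega>) u"
  using continuous_on_interior[OF continuous_paths[OF assms(1)], of u] assms(2) by simp

lemma increment_event:
  assumes "0 \<le> s" "0 \<le> t"
  shows "{\<omega>\<in>space M. W t \<omega> - W s \<omega> \<le> d} \<in> events"
  using random_variable[OF assms(1)] random_variable[OF assms(2)] by measurable

text \<open>For order -1 the weight \<open>u powr 0\<close> and \<open>Gamma 1\<close> are both 1,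
  so \<open>gauss_pcf (-1) z\<close> is the integral of \<open>exp (- x^2 / 2)\<close> over x >
  z.\<close>

lemma prob_increment_le:
  assumes "0 \<le> s" "s < t"
  shows "prob {\<omega>\<in>space M. W t \<omega> - W s \<omega> \<le> c} = gauss_pcf (-1) (- c / sqrt (t - s)) / sqrt (2 * pi)"
proof -
  define \<sigma> where "\<sigma> = sqrt (t - s)"
  let ?z = "- c / \<sigma>"
  have \<sigma>: "\<sigma> > 0" using assms by (simp add: \<sigma>_def)
  let ?f = "\<lambda>x. normal_density 0 \<sigma> x * indicator {..c} x"
  have int: "integrable lborel ?f"
    using \<sigma> by (intro integrable_real_mult_indicator integrable_normal_density) auto
  have "emeasure M ((\<lambda>\<omega>. W t \<omega> - W s \<omega>) -` {..c} \<inter> space M) =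
      (\<integral>\<^sup>+x. ennreal (normal_density 0 \<sigma> x) * indicator {..c} x \<partial>lborel)"
    using normal_increments[OF assms, folded \<sigma>_def] by (rule distributed_emeasure) auto
  also have "\<dots> = (\<integral>\<^sup>+x. ennreal (?f x) \<partial>lborel)"
    by (intro nn_integral_cong) (auto simp: indicator_def)
  also have "\<dots> = ennreal (\<integral>x. ?f x \<partial>lborel)"
    using int by (rule nn_integral_eq_integral) auto
  finally have "prob ((\<lambda>\<omega>. W t \<omega> - W s \<omega>) -` {..c} \<inter> space M) = (\<integral>x. ?f x \<partial>lborel)"
    by (simp add: measure_def integral_nonneg)
  \<comment> \<open>The reflection \<open>x = c - \<sigma> * u\<close> maps the half-line below c to
    u \<ge> 0; the point u = 0, where the two indicators differ, is null.\<close>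
  also have "\<dots> = \<sigma> * (\<integral>u. ?f (c + (- \<sigma>) * u) \<partial>lborel)"
    using \<sigma> by (subst lborel_integral_real_affine[of "- \<sigma>" _ c]) auto
  also have "\<dots> = (\<integral>u. \<sigma> * ?f (c + (- \<sigma>) * u) \<partial>lborel)"
    by (rule integral_mult_right_zero[symmetric])
  also have "\<dots> = (\<integral>u. indicator {0<..} u *\<^sub>R (u powr (- (-1) - 1) * exp (- (?z + u)\<^sup>2 / 2)) / sqrt (2 * pi) \<partial>lborel)"
  proof (rule integral_cong_AE)
    show "AE u in lborel. \<sigma> * ?f (c + (- \<sigma>) * u) =
        indicator {0<..} u *\<^sub>R (u powr (- (-1) - 1) * exp (- (?z + u)\<^sup>2 / 2)) / sqrt (2 * pi)"
      using AE_lborel_singleton[of "0::real"]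
    proof eventually_elim
      case (elim u)
      have "(c - \<sigma> * u)\<^sup>2 / (2 * \<sigma>\<^sup>2) = (?z + u)\<^sup>2 / 2"
      proof -
        have "c - \<sigma> * u = - \<sigma> * (?z + u)" using \<sigma> by (simp add: algebra_simps)
        then show ?thesis using \<sigma> by (simp add: power_mult_distrib)
      qed
      moreover have "sqrt (2 * pi * \<sigma>\<^sup>2) = sqrt (2 * pi) * \<sigma>"
        using \<sigma> by (simp add: real_sqrt_mult)
      moreover have "0 \<le> \<sigma> * u \<longleftrightarrow> 0 < u" using \<sigma> elim by (auto simp: zero_le_mult_iff)
      ultimately show ?case
        using \<sigma> elim by (simp add: normal_density_def indicator_def)
    qed
  qed auto
  also have "\<dots> = gauss_pcf (-1) ?z / sqrt (2 * pi)"
    by (simp add: gauss_pcf_neg[of "-1"] set_lebesgue_integral_def)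
  finally show ?thesis by (simp add: vimage_def Int_def conj_commute \<sigma>_def)
qed

text \<open>Discards the paths with \<open>W t \<omega> = y\<close>, on which the indicators of the
  cell events need not converge.\<close>

lemma AE_path_neq:
  assumes "0 < t"
  shows "AE \<omega> in M. W t \<omega> \<noteq> y"
proof -
  have "emeasure M ((\<lambda>\<omega>. W t \<omega> - W 0 \<omega>) -` {y} \<inter> space M) =
      (\<integral>\<^sup>+x. ennreal (normal_density 0 (sqrt (t - 0)) x) * indicator {y} x \<partial>lborel)"
    using normal_increments[of 0 t] assms by (intro distributed_emeasure) auto
  also have "\<dots> = 0"
    by (subst nn_integral_0_iff_AE) (use AE_lborel_singleton[of y] in \<open>auto elim: eventually_mono\<close>)
  finally have "emeasure M ((\<lambda>\<omega>. W t \<omega> - W 0 \<omega>) -` {y} \<inter> space M) = 0" .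
  moreover have "{\<omega>\<in>space M. \<not> W t \<omega> \<noteq> y} = (\<lambda>\<omega>. W t \<omega> - W 0 \<omega>) -` {y} \<inter> space M"
    using start_zero by auto
  moreover have "{\<omega>\<in>space M. \<not> W t \<omega> \<noteq> y} \<in> events"
    using measurable_sets[OF random_variable[of t], of "{y}"] assms
    by (simp add: vimage_def Int_def conj_commute)
  ultimately show ?thesis by (intro AE_I[of _ _ "{\<omega>\<in>space M. \<not> W t \<omega> \<noteq> y}"]) auto
qed

end

section \<open>Hitting events as limits of grid events\<close>

locale brownian_boundary = standard_brownian_motion +
  fixes b :: "real \<Rightarrow> real"
  assumes boundary_continuous: "continuous_on {0<..} b"
begin

text \<open>For s > 0 this is the event \<tau> \<le> s. For s \<le> 0 it is empty; at s = 0 it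
  misses only \<tau> = 0, a null event under regularity.\<close>

definition hit :: "real \<Rightarrow> 'a set" where
  "hit s = {\<omega>\<in>space M. \<exists>u. 0 < u \<and> u \<le> s \<and> W u \<omega> \<le> b u}"

lemma isCont_boundary: "0 < u \<Longrightarrow> isCont b u"
  using continuous_on_interior[OF boundary_continuous, of u] by (simp add: interior_open)

lemma hit_nonpos: "s \<le> 0 \<Longrightarrow> hit s = {}"
  by (auto simp: hit_def)

lemma hit_mono: "s \<le> s' \<Longrightarrow> hit s \<subseteq> hit s'"
  by (auto simp: hit_def intro: order_trans)

text \<open>Each index has its own limit. The dyadic level m makes the times finite in number and
  nested; the slack \<open>1 / real (Suc j)\<close> lets a grid point stand in for a nearby contact
  point; the cutoff \<open>s / 2 ^ n\<close> keeps the times in a compact set away from 0, where b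
  need not be continuous.\<close>

definition grid_hit :: "real \<Rightarrow> nat \<Rightarrow> nat \<Rightarrow> nat \<Rightarrow> 'a set" where
  "grid_hit s n j m = {\<omega>\<in>space M. \<exists>k\<in>{k. k \<le> 2 ^ m \<and> s / 2 ^ n \<le> real k * s / real (2 ^ m)}.
     W (real k * s / real (2 ^ m)) \<omega> < b (real k * s / real (2 ^ m)) + 1 / real (Suc j)}"

lemma grid_hit_event:
  assumes "0 < s"
  shows "grid_hit s n j m \<in> events"
proof -
  have "grid_hit s n j m = (\<Union>k\<in>{k. k \<le> 2 ^ m \<and> s / 2 ^ n \<le> real k * s / real (2 ^ m)}.
     {\<omega>\<in>space M. W (real k * s / real (2 ^ m)) \<omega> < b (real k * s / real (2 ^ m)) + 1 / real (Suc j)})"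
    by (auto simp: grid_hit_def)
  also have "\<dots> \<in> events"
  proof (intro sets.finite_UN)
    fix k :: nat
    have [measurable]: "random_variable borel (W (real k * s / real (2 ^ m)))"
      using assms by (intro random_variable) auto
    show "{\<omega>\<in>space M. W (real k * s / real (2 ^ m)) \<omega> <
        b (real k * s / real (2 ^ m)) + 1 / real (Suc j)} \<in> events" by measurable
  qed auto
  finally show ?thesis .
qed

lemma incseq_grid_hit: "incseq (grid_hit s n j)"
proof (rule incseq_SucI)
  fix m
  show "grid_hit s n j m \<subseteq> grid_hit s n j (Suc m)"
  proof
    fix \<omega> assume "\<omega> \<in> grid_hit s n j m"
    then obtain k where "\<omega> \<in> space M" "k \<le> 2 ^ m" "s / 2 ^ n \<le> real k * s / real (2 ^ m)"
      "W (real k * s / real (2 ^ m)) \<omega> < b (real k * s / real (2 ^ m)) + 1 / real (Suc j)"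
      by (auto simp: grid_hit_def)
    moreover have "real (2 * k) * s / real (2 ^ Suc m) = real k * s / real (2 ^ m)" by simp
    ultimately show "\<omega> \<in> grid_hit s n j (Suc m)"
      unfolding grid_hit_def by (intro CollectI conjI bexI[of _ "2 * k"]) (simp_all only:, simp_all)
  qed
qed

lemma decseq_grid_hit: "decseq (\<lambda>j. \<Union>m. grid_hit s n j m)"
proof (rule decseq_SucI)
  fix j
  have "1 / real (Suc (Suc j)) \<le> 1 / real (Suc j)" by (simp add: field_simps)
  then show "(\<Union>m. grid_hit s n (Suc j) m) \<subseteq> (\<Union>m. grid_hit s n j m)"
    unfolding grid_hit_def by (fastforce intro: less_le_trans)
qed

text \<open>On the compact interval \<open>W u \<omega> - b u\<close> attains its minimum, and slack
  for every j forces it to be at most 0. Conversely, dyadic points close enough to a contact point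
  meet any given slack.\<close>

lemma hit_eq_compact:
  assumes "0 < s"
  shows "(\<Inter>j. \<Union>m. grid_hit s n j m) = {\<omega>\<in>space M. \<exists>u. s / 2 ^ n \<le> u \<and> u \<le> s \<and> W u \<omega> \<le> b u}"
    (is "?L = ?R")
proof (intro subset_antisym subsetI)
  fix \<omega> assume L: "\<omega> \<in> ?L"
  then have \<omega>: "\<omega> \<in> space M" by (auto simp: grid_hit_def)
  have pos: "0 < s / 2 ^ n" using assms by simp
  have cont: "continuous_on {s / 2 ^ n..s} (\<lambda>u. W u \<omega> - b u)"
  proof (intro continuous_intros)
    show "continuous_on {s / 2 ^ n..s} (\<lambda>u. W u \<omega>)"
      using pos by (intro continuous_on_subset[OF continuous_paths[OF \<omega>]]) auto
    show "continuous_on {s / 2 ^ n..s} b"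
      using pos by (intro continuous_on_subset[OF boundary_continuous]) auto
  qed
  have "s / 2 ^ n \<le> s / 1" using assms by (intro divide_left_mono) auto
  then obtain v where v: "v \<in> {s / 2 ^ n..s}" "\<And>u. u \<in> {s / 2 ^ n..s} \<Longrightarrow> W v \<omega> - b v \<le> W u \<omega> - b u"
    using continuous_attains_inf[OF _ _ cont] by auto
  have "W v \<omega> - b v \<le> 1 / real (Suc j)" for j
  proof -
    from L obtain m k where k: "k \<le> 2 ^ m" "s / 2 ^ n \<le> real k * s / real (2 ^ m)"
      "W (real k * s / real (2 ^ m)) \<omega> < b (real k * s / real (2 ^ m)) + 1 / real (Suc j)"
      by (fastforce simp: grid_hit_def)
    have "real k \<le> real (2 ^ m)" using k(1) by (simp only: of_nat_le_iff)
    then have "real k * s / real (2 ^ m) \<le> s" using assms by (simp add: field_simps)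
    with v(2)[of "real k * s / real (2 ^ m)"] k show ?thesis by simp
  qed
  then have "W v \<omega> - b v \<le> 0"
    by (intro LIMSEQ_le_const[OF LIMSEQ_Suc[OF lim_1_over_n]]) (auto simp del: of_nat_Suc)
  then show "\<omega> \<in> ?R" using v(1) \<omega> by auto
next
  fix \<omega> assume "\<omega> \<in> ?R"
  then obtain u where \<omega>: "\<omega> \<in> space M" and u: "s / 2 ^ n \<le> u" "u \<le> s" "W u \<omega> \<le> b u" by auto
  have u0: "0 < u" using assms u(1) by (smt (verit) divide_pos_pos zero_less_power)
  \<comment> \<open>Rounding up keeps the grid point at or above u, hence above the cutoff; it stays
    at most s because u \<le> s.\<close>
  define kk where "kk = (\<lambda>m. nat \<lceil>u * 2 ^ m / s\<rceil>)"
  define v where "v = (\<lambda>m. real (kk m) * s / real (2 ^ m))"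
  have kk: "u * 2 ^ m / s \<le> real (kk m)" "real (kk m) \<le> u * 2 ^ m / s + 1" for m
    using u0 assms by (auto simp: kk_def)
  have v: "u \<le> v m" "v m \<le> u + s * (1 / 2) ^ m" for m
    using kk[of m] assms by (auto simp: v_def field_simps)
  have kle: "kk m \<le> 2 ^ m" for m
  proof -
    have "u * 2 ^ m / s \<le> 2 ^ m" using u(2) assms by (simp add: field_simps)
    then have "\<lceil>u * 2 ^ m / s\<rceil> \<le> 2 ^ m" by (simp add: ceiling_le_iff)
    then show ?thesis by (simp add: kk_def nat_le_iff)
  qed
  have "v \<longlonglongrightarrow> u"
  proof (rule tendsto_sandwich[of "\<lambda>_. u" v _ "\<lambda>m. u + s * (1 / 2) ^ m"])
    have "(\<lambda>m. u + s * (1 / 2) ^ m) \<longlonglongrightarrow> u + s * 0"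
      by (intro tendsto_intros LIMSEQ_realpow_zero) auto
    then show "(\<lambda>m. u + s * (1 / 2) ^ m) \<longlonglongrightarrow> u" by simp
  qed (use v in auto)
  then have lim: "(\<lambda>m. W (v m) \<omega> - b (v m)) \<longlonglongrightarrow> W u \<omega> - b u"
    using isCont_tendsto_compose[OF isCont_path[OF \<omega> u0]] isCont_tendsto_compose[OF isCont_boundary[OF u0]]
    by (intro tendsto_diff)
  have "\<exists>m. \<omega> \<in> grid_hit s n j m" for j
  proof -
    have "W u \<omega> - b u < 1 / real (Suc j)" using u(3) by (smt (verit) divide_pos_pos of_nat_0_less_iff zero_less_Suc)
    from order_tendstoD(2)[OF lim this] obtain m where "W (v m) \<omega> - b (v m) < 1 / real (Suc j)"
      by (meson eventually_sequentially order_refl)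
    then show ?thesis
      using v(1)[of m] u(1) kle[of m] \<omega> unfolding grid_hit_def v_def
      by (intro exI[of _ m] CollectI conjI bexI[of _ "kk m"]) auto
  qed
  then show "\<omega> \<in> ?L" by auto
qed

lemma hit_eq_UN:
  assumes "0 < s"
  shows "hit s = (\<Union>n. \<Inter>j. \<Union>m. grid_hit s n j m)"
proof -
  have "\<exists>n. s / 2 ^ n \<le> u" if u: "0 < u" for u
  proof -
    obtain n where "(1 / 2) ^ n < u / s"
      using real_arch_pow_inv[of "u / s" "1 / 2"] u assms by auto
    then show ?thesis using assms by (intro exI[of _ n]) (simp add: field_simps)
  qed
  moreover have "0 < s / 2 ^ n" for n using assms by simp
  ultimately show ?thesis
    unfolding hit_eq_compact[OF assms] hit_def by (blast intro: less_le_trans)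
qed

lemma incseq_hit_compact:
  assumes "0 < s"
  shows "incseq (\<lambda>n. \<Inter>j. \<Union>m. grid_hit s n j m)"
  unfolding hit_eq_compact[OF assms]
proof (rule incseq_SucI)
  fix n
  have "s / 2 ^ Suc n \<le> s / 2 ^ n" using assms by (simp add: field_simps)
  then show "{\<omega>\<in>space M. \<exists>u. s / 2 ^ n \<le> u \<and> u \<le> s \<and> W u \<omega> \<le> b u} \<subseteq>
      {\<omega>\<in>space M. \<exists>u. s / 2 ^ Suc n \<le> u \<and> u \<le> s \<and> W u \<omega> \<le> b u}"
    by (auto intro: order_trans)
qed

lemma hit_event: "hit s \<in> events"
proof (cases "0 < s")
  case True
  then show ?thesis unfolding hit_eq_UN[OF True] using grid_hit_event[OF True] by auto
qed (simp add: hit_nonpos)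

lemma prob_hit_Int_increment:
  assumes "u \<le> s" "0 < s" "s < t"
  shows "prob (hit u \<inter> {\<omega>\<in>space M. W t \<omega> - W s \<omega> \<le> d}) =
    prob (hit u) * prob {\<omega>\<in>space M. W t \<omega> - W s \<omega> \<le> d}"
proof (cases "0 < u")
  case True
  note ev = grid_hit_event[OF True]
  have B: "{\<omega>\<in>space M. W t \<omega> - W s \<omega> \<le> d} \<in> events"
    using assms by (intro increment_event) auto
  have 1: "prob (grid_hit u n j m \<inter> {\<omega>\<in>space M. W t \<omega> - W s \<omega> \<le> d}) =
      prob (grid_hit u n j m) * prob {\<omega>\<in>space M. W t \<omega> - W s \<omega> \<le> d}" for n j m
    unfolding grid_hit_def using True assms by (intro prob_grid_Int_increment) auto
  have 2: "prob ((\<Union>m. grid_hit u n j m) \<inter> {\<omega>\<in>space M. W t \<omega> - W s \<omega> \<le> d}) =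
      prob (\<Union>m. grid_hit u n j m) * prob {\<omega>\<in>space M. W t \<omega> - W s \<omega> \<le> d}" for n j
    by (intro prob_Int_UN_incseq incseq_grid_hit ev B 1)
  have 3: "prob ((\<Inter>j. \<Union>m. grid_hit u n j m) \<inter> {\<omega>\<in>space M. W t \<omega> - W s \<omega> \<le> d}) =
      prob (\<Inter>j. \<Union>m. grid_hit u n j m) * prob {\<omega>\<in>space M. W t \<omega> - W s \<omega> \<le> d}" for n
    using ev by (intro prob_Int_INT_decseq decseq_grid_hit B 2) auto
  show ?thesis
    unfolding hit_eq_UN[OF True]
    using ev by (intro prob_Int_UN_incseq incseq_hit_compact True B 3) auto
qed (simp add: hit_nonpos)

end

section \<open>The strong Markov property at the passage time\<close>

text \<open>The last cell is omitted because its right endpoint is \<open>t\<close>, where the integrand degenerates.\<close>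

definition right_endpoint_sum :: "real \<Rightarrow> nat \<Rightarrow> (real \<Rightarrow> real) \<Rightarrow> real \<Rightarrow> real" where
  "right_endpoint_sum t n H s =
     (\<Sum>k<n. indicator {real k * t / real (Suc n)<..real (Suc k) * t / real (Suc n)} s *
        H (real (Suc k) * t / real (Suc n)))"

text \<open>The half-open cells are disjoint, so the sum samples H at the right endpoint v of the
  one containing s. The omitted cell is the one with v = t, whence the value 0.\<close>

lemma right_endpoint_sum_eq:
  assumes s: "0 < s" "s \<le> t"
  obtains v where "s \<le> v" "v \<le> s + t / real (Suc n)"
    "\<And>H. right_endpoint_sum t n H s = (if v < t then H v else 0)"
proof -
  \<comment> \<open>Cells are open on the left and closed on the right, so the index is a ceiling
    minus one rather than a floor.\<close>
  define c where "c = nat (\<lceil>s * real (Suc n) / t\<rceil> - 1)"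
  define v where "v = real (Suc c) * t / real (Suc n)"
  have t: "0 < t" using s by simp
  have c1: "real c < s * real (Suc n) / t" "s * real (Suc n) / t \<le> real (Suc c)"
  proof -
    have "0 < s * real (Suc n) / t" using s t by simp
    then have "1 \<le> \<lceil>s * real (Suc n) / t\<rceil>" by linarith
    then have "real c = of_int \<lceil>s * real (Suc n) / t\<rceil> - 1" by (simp add: c_def)
    then show "real c < s * real (Suc n) / t" "s * real (Suc n) / t \<le> real (Suc c)"
      by linarith+
  qed
  have cell: "indicator {real k * t / real (Suc n)<..real (Suc k) * t / real (Suc n)} s =
      (if k = c then 1 else 0 :: real)" for k
  proof -
    have "s \<in> {real k * t / real (Suc n)<..real (Suc k) * t / real (Suc n)} \<longleftrightarrow>
        real k < s * real (Suc n) / t \<and> s * real (Suc n) / t \<le> real (Suc k)"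
      using t by (simp add: pos_less_divide_eq pos_divide_less_eq pos_le_divide_eq pos_divide_le_eq del: of_nat_Suc)
    also have "\<dots> \<longleftrightarrow> k = c"
    proof
      assume "real k < s * real (Suc n) / t \<and> s * real (Suc n) / t \<le> real (Suc k)"
      with c1 have "real k < real (Suc c)" "real c < real (Suc k)" by linarith+
      then show "k = c" unfolding of_nat_less_iff by simp
    qed (use c1 in auto)
    finally show ?thesis by (auto simp: indicator_def)
  qed
  show ?thesis
  proof (rule that)
    show "s \<le> v" using c1(2) t by (simp add: v_def pos_le_divide_eq pos_divide_le_eq del: of_nat_Suc)
    have "v = real c * t / real (Suc n) + t / real (Suc n)"
      by (simp add: v_def distrib_right add_divide_distrib)
    moreover have "real c * t / real (Suc n) \<le> s"
      using c1(1) t by (simp add: pos_less_divide_eq pos_divide_le_eq del: of_nat_Suc)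
    ultimately show "v \<le> s + t / real (Suc n)" by simp
    fix H
    have "v < t \<longleftrightarrow> real (Suc c) * t < real (Suc n) * t"
      by (simp add: v_def pos_divide_less_eq mult.commute del: of_nat_Suc)
    also have "\<dots> \<longleftrightarrow> c < n" using t by simp
    finally have "v < t \<longleftrightarrow> c < n" .
    moreover have "(\<Sum>k<n. (if k = c then 1 else 0 :: real) * H (real (Suc k) * t / real (Suc n))) =
        (\<Sum>k<n. if k = c then H v else 0)"
      by (intro sum.cong) (auto simp: v_def)
    ultimately show "right_endpoint_sum t n H s = (if v < t then H v else 0)"
      unfolding right_endpoint_sum_def cell by simp
  qed
qed

lemma right_endpoint_sum_bound:
  assumes "0 < s" "s \<le> t" and "\<And>u. 0 < u \<Longrightarrow> u < t \<Longrightarrow> \<bar>H u\<bar> \<le> 1"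
  shows "\<bar>right_endpoint_sum t n H s\<bar> \<le> 1"
proof -
  obtain v where "s \<le> v" "right_endpoint_sum t n H s = (if v < t then H v else 0)"
    using right_endpoint_sum_eq[OF assms(1,2)] by metis
  then show ?thesis using assms by auto
qed

lemma tendsto_right_endpoint_sum:
  assumes s: "0 < s" "s \<le> t" and H: "s < t \<Longrightarrow> isCont H s"
  shows "(\<lambda>n. right_endpoint_sum t n H s) \<longlonglongrightarrow> (if s < t then H s else 0)"
proof -
  have "\<exists>v. s \<le> v \<and> v \<le> s + t / real (Suc n) \<and>
      right_endpoint_sum t n H s = (if v < t then H v else 0)" for n
    using right_endpoint_sum_eq[OF s] by metis
  then obtain v where v: "\<And>n. s \<le> v n" "\<And>n. v n \<le> s + t / real (Suc n)"
    and sum_eq: "\<And>n. right_endpoint_sum t n H s = (if v n < t then H (v n) else 0)"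
    by metis
  show ?thesis
  proof (cases "s < t")
    case True
    have "(\<lambda>n. s + t / real (Suc n)) \<longlonglongrightarrow> s + 0"
      by (intro tendsto_intros LIMSEQ_Suc[OF lim_const_over_n])
    then have "v \<longlonglongrightarrow> s"
      by (intro tendsto_sandwich[of "\<lambda>_. s" v _ "\<lambda>n. s + t / real (Suc n)"] always_eventually allI v) auto
    then have "(\<lambda>n. H (v n)) \<longlonglongrightarrow> H s"
      by (rule isCont_tendsto_compose[OF H[OF True]])
    moreover have "\<forall>\<^sub>F n in sequentially. H (v n) = (if v n < t then H (v n) else 0)"
      using order_tendstoD(2)[OF \<open>v \<longlonglongrightarrow> s\<close> True] by eventually_elim simp
    ultimately show ?thesis
      unfolding sum_eq using True by (auto intro: Lim_transform_eventually)
  next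
    case False
    then have "\<not> v n < t" for n using v(1)[of n] s by simp
    then show ?thesis unfolding sum_eq using False by simp
  qed
qed

section \<open>The passage time and its distribution function\<close>

context brownian_boundary
begin

text \<open>Without contact up to s, continuity keeps W above b slightly beyond s, so the infimum
  exceeds s. Positivity of s is what makes b continuous there.\<close>

lemma passage_time_le_iff:
  assumes \<omega>: "\<omega> \<in> space M" and "0 < s"
  shows "passage_time W b \<omega> \<le> ereal s \<longleftrightarrow> \<omega> \<in> hit s"
proof
  assume "\<omega> \<in> hit s"
  then obtain u where u: "0 < u" "u \<le> s" "W u \<omega> \<le> b u" by (auto simp: hit_def)
  have "passage_time W b \<omega> \<le> ereal u"
    unfolding passage_time_def by (rule Inf_lower) (use u in auto)
  with u(2) show "passage_time W b \<omega> \<le> ereal s" by (meson ereal_less_eq(3) order_trans)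
next
  assume le: "passage_time W b \<omega> \<le> ereal s"
  show "\<omega> \<in> hit s"
  proof (rule ccontr)
    assume no: "\<omega> \<notin> hit s"
    then have no: "b u < W u \<omega>" if "0 < u" "u \<le> s" for u
      using that \<omega> unfolding hit_def by force
    have "isCont (\<lambda>u. W u \<omega> - b u) s"
      by (intro continuous_intros isCont_path isCont_boundary assms)
    then have "((\<lambda>u. W u \<omega> - b u) \<longlongrightarrow> W s \<omega> - b s) (nhds s)"
      unfolding isCont_def by (rule iffD1[OF tendsto_at_iff_tendsto_nhds])
    from order_tendstoD(1)[OF this, of 0] have "\<forall>\<^sub>F u in nhds s. 0 < W u \<omega> - b u"
      using no[of s] assms by simp
    then obtain d where d: "d > 0" "\<And>u. dist u s < d \<Longrightarrow> 0 < W u \<omega> - b u"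
      by (auto simp: eventually_nhds_metric)
    have "ereal (s + d) \<le> passage_time W b \<omega>"
      unfolding passage_time_def
    proof (rule Inf_greatest)
      fix x assume "x \<in> {ereal u |u. 0 < u \<and> W u \<omega> \<le> b u}"
      then obtain u where u: "x = ereal u" "0 < u" "W u \<omega> \<le> b u" by auto
      have "s + d \<le> u"
      proof (rule ccontr)
        assume "\<not> s + d \<le> u"
        then show False
          using no[of u] d(2)[of u] u by (cases "u \<le> s") (auto simp: dist_real_def)
      qed
      with u(1) show "ereal (s + d) \<le> x" by simp
    qed
    then have "ereal (s + d) \<le> ereal s" using le by (rule order_trans)
    with d(1) show False by simp
  qed
qed

lemma passage_time_nonneg: "0 \<le> passage_time W b \<omega>"
  unfolding passage_time_def by (rule Inf_greatest) auto

lemma passage_set_eq: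
  "0 < s \<Longrightarrow> {\<omega> \<in> space M. passage_time W b \<omega> \<le> ereal s} = hit s"
  using passage_time_le_iff by (auto simp: hit_def)

lemma passage_cdf_pos: "0 < s \<Longrightarrow> passage_cdf M W b s = prob (hit s)"
  by (simp add: passage_cdf_def passage_set_eq)

text \<open>Serves for measurability at s = 0, where the event is not of the form
  \<open>hit s\<close>, and for right continuity of the distribution function.\<close>

lemma passage_set_INT:
  "{\<omega> \<in> space M. passage_time W b \<omega> \<le> ereal s} =
    (\<Inter>n. {\<omega> \<in> space M. passage_time W b \<omega> \<le> ereal (s + 1 / real (Suc n))})"
proof (intro subset_antisym subsetI)
  fix \<omega> assume "\<omega> \<in> {\<omega> \<in> space M. passage_time W b \<omega> \<le> ereal s}"
  moreover have "ereal s \<le> ereal (s + 1 / real (Suc n))" for n by simp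
  ultimately show "\<omega> \<in> (\<Inter>n. {\<omega> \<in> space M. passage_time W b \<omega> \<le> ereal (s + 1 / real (Suc n))})"
    by (blast intro: order_trans)
next
  fix \<omega> assume \<omega>: "\<omega> \<in> (\<Inter>n. {\<omega> \<in> space M. passage_time W b \<omega> \<le> ereal (s + 1 / real (Suc n))})"
  have "(\<lambda>n. s + 1 / real (Suc n)) \<longlonglongrightarrow> s + 0"
    by (intro tendsto_intros LIMSEQ_Suc[OF lim_1_over_n])
  then have "(\<lambda>n. ereal (s + 1 / real (Suc n))) \<longlonglongrightarrow> ereal s" by simp
  then have "passage_time W b \<omega> \<le> ereal s"
    by (rule LIMSEQ_le_const) (use \<omega> in auto)
  then show "\<omega> \<in> {\<omega> \<in> space M. passage_time W b \<omega> \<le> ereal s}" using \<omega> by auto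
qed

lemma passage_set_neg:
  assumes "s < 0"
  shows "{\<omega> \<in> space M. passage_time W b \<omega> \<le> ereal s} = {}"
proof -
  have "\<not> passage_time W b \<omega> \<le> ereal s" for \<omega>
  proof
    assume "passage_time W b \<omega> \<le> ereal s"
    with passage_time_nonneg[of \<omega>] have "0 \<le> ereal s" by (rule order_trans)
    with assms show False by simp
  qed
  then show ?thesis by simp
qed

lemma passage_set_event: "{\<omega> \<in> space M. passage_time W b \<omega> \<le> ereal s} \<in> events"
proof (cases "s < 0")
  case False
  have "{\<omega> \<in> space M. passage_time W b \<omega> \<le> ereal (s + 1 / real (Suc n))} \<in> events" for n
  proof -
    have "0 < 1 / real (Suc n)" by simp
    then have "0 < s + 1 / real (Suc n)" using False by linarith
    then show ?thesis by (simp only: passage_set_eq hit_event)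
  qed
  then show ?thesis by (subst passage_set_INT) blast
qed (simp add: passage_set_neg)

lemma passage_cdf_mono: "s \<le> s' \<Longrightarrow> passage_cdf M W b s \<le> passage_cdf M W b s'"
  unfolding passage_cdf_def
  by (intro finite_measure_mono passage_set_event) (auto intro: order_trans)

lemma passage_cdf_right_cont: "continuous (at_right s) (passage_cdf M W b)"
proof (rule continuous_at_right_real_increasing[THEN iffD2, rule_format])
  show "passage_cdf M W b x \<le> passage_cdf M W b x'" if "x \<le> x'" for x x'
    using that by (rule passage_cdf_mono)
  fix e :: real assume "e > 0"
  let ?A = "\<lambda>n. {\<omega> \<in> space M. passage_time W b \<omega> \<le> ereal (s + 1 / real (Suc n))}"
  have "decseq ?A"
  proof (rule decseq_SucI)
    fix n
    have "ereal (s + 1 / real (Suc (Suc n))) \<le> ereal (s + 1 / real (Suc n))" by (simp add: field_simps)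
    then show "?A (Suc n) \<subseteq> ?A n" by (blast intro: order_trans)
  qed
  then have "(\<lambda>n. prob (?A n)) \<longlonglongrightarrow> prob (\<Inter>n. ?A n)"
    using passage_set_event by (intro finite_Lim_measure_decseq) auto
  then have "(\<lambda>n. passage_cdf M W b (s + 1 / real (Suc n))) \<longlonglongrightarrow> passage_cdf M W b s"
    by (simp only: passage_cdf_def passage_set_INT[of s])
  then have "\<forall>\<^sub>F n in sequentially. passage_cdf M W b (s + 1 / real (Suc n)) < passage_cdf M W b s + e"
    using \<open>e > 0\<close> by (intro order_tendstoD) auto
  then obtain n where "passage_cdf M W b (s + 1 / real (Suc n)) < passage_cdf M W b s + e"
    by (meson eventually_sequentially order_refl)
  then show "\<exists>d>0. passage_cdf M W b (s + d) - passage_cdf M W b s < e"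
    by (intro exI[of _ "1 / real (Suc n)"]) auto
qed

text \<open>The infimum is attained, so W \<le> b at the passage time; before it W > b, and the
  limit from the left gives W \<ge> b. Excluding passage time 0 makes s positive.\<close>

lemma first_hit:
  assumes \<omega>: "\<omega> \<in> hit t" and pos: "passage_time W b \<omega> \<noteq> 0"
  obtains s where "0 < s" "s \<le> t" "W s \<omega> = b s" "\<And>u. \<omega> \<in> hit u \<longleftrightarrow> s \<le> u"
proof -
  have sp: "\<omega> \<in> space M" and t: "0 < t" using \<omega> by (auto simp: hit_def)
  have le: "passage_time W b \<omega> \<le> ereal t" using passage_time_le_iff[OF sp t] \<omega> by simp
  then obtain s where s: "passage_time W b \<omega> = ereal s"
    using passage_time_nonneg[of \<omega>] by (cases "passage_time W b \<omega>") auto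
  have s0: "0 < s" using passage_time_nonneg[of \<omega>] pos unfolding s by simp
  have hit: "\<omega> \<in> hit u \<longleftrightarrow> s \<le> u" for u
  proof (cases "0 < u")
    case True
    then show ?thesis using passage_time_le_iff[OF sp True] by (simp add: s)
  qed (use s0 in \<open>simp add: hit_nonpos\<close>)
  have before: "b u < W u \<omega>" if "0 < u" "u < s" for u
  proof (rule ccontr)
    assume "\<not> b u < W u \<omega>"
    then have "\<omega> \<in> hit u" using that sp by (auto simp: hit_def)
    with hit that show False by simp
  qed
  obtain v where "0 < v" "v \<le> s" "W v \<omega> \<le> b v" using hit[of s] by (auto simp: hit_def)
  with before[of v] have le: "W s \<omega> \<le> b s" by (cases "v = s") auto
  have "isCont (\<lambda>u. W u \<omega> - b u) s"
    by (intro continuous_intros isCont_path isCont_boundary s0 sp)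
  then have "((\<lambda>u. W u \<omega> - b u) \<longlongrightarrow> W s \<omega> - b s) (at_left s)"
    unfolding isCont_def by (rule tendsto_within_subset) auto
  moreover have "\<forall>\<^sub>F u in at_left s. 0 \<le> W u \<omega> - b u"
    using eventually_at_left_real[OF s0] by eventually_elim (use before in \<open>auto simp: less_imp_le\<close>)
  ultimately have "0 \<le> W s \<omega> - b s"
    by (rule tendsto_lowerbound) simp
  with le have "W s \<omega> = b s" by simp
  with that s0 hit \<omega> show ?thesis by blast
qed

text \<open>For 0 \<le> s < t this is the probability of \<open>W t - W s \<le> y - b s\<close>,
  that is, of ending at or below y after leaving the boundary at time s.\<close>

definition boundary_normal_cdf :: "real \<Rightarrow> real \<Rightarrow> real \<Rightarrow> real" where
  "boundary_normal_cdf t y s = gauss_pcf (-1) ((b s - y) / sqrt (t - s)) / sqrt (2 * pi)"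

lemma isCont_boundary_normal_cdf:
  assumes "0 < s" "s < t"
  shows "isCont (boundary_normal_cdf t y) s"
proof -
  have "isCont (\<lambda>s. gauss_pcf (-1) ((b s - y) / sqrt (t - s))) s"
  proof (rule isCont_o2[where g = "gauss_pcf (-1)"])
    show "isCont (\<lambda>s. (b s - y) / sqrt (t - s)) s"
      using assms by (intro continuous_intros isCont_boundary) auto
    show "isCont (gauss_pcf (-1)) ((b s - y) / sqrt (t - s))"
      using gauss_pcf_has_real_derivative by (rule DERIV_isCont)
  qed
  then show ?thesis unfolding boundary_normal_cdf_def[abs_def] by (intro continuous_intros) auto
qed

end

section \<open>Partition sums for the strong Markov property\<close>

locale regular_brownian_boundary = brownian_boundary +
  assumes regular: "prob {\<omega> \<in> space M. passage_time W b \<omega> = 0} = 0"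
begin

lemma passage_cdf_eq: "0 \<le> s \<Longrightarrow> passage_cdf M W b s = prob (hit s)"
proof (cases "s = 0")
  case True
  have "passage_time W b \<omega> \<le> 0 \<longleftrightarrow> passage_time W b \<omega> = 0" for \<omega>
    using passage_time_nonneg[of \<omega>] by (auto intro: antisym)
  then show ?thesis using regular True by (simp add: passage_cdf_def hit_nonpos zero_ereal_def[symmetric])
qed (simp add: passage_cdf_pos)

lemma AE_passage_time_nonzero: "AE \<omega> in M. passage_time W b \<omega> \<noteq> 0"
proof -
  have eq: "passage_time W b \<omega> \<le> ereal 0 \<longleftrightarrow> passage_time W b \<omega> = 0" for \<omega>
    using passage_time_nonneg[of \<omega>] by (auto intro: antisym simp: zero_ereal_def[symmetric])
  have "{\<omega> \<in> space M. passage_time W b \<omega> = 0} \<in> events"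
    using passage_set_event[of 0] by (simp only: eq)
  then show ?thesis
    using regular by (subst AE_iff_measurable[OF _ refl]) (auto simp: emeasure_eq_measure)
qed

abbreviation "\<mu> \<equiv> interval_measure (passage_cdf M W b)"

lemma measure_Ioc: "s \<le> s' \<Longrightarrow> measure \<mu> {s<..s'} = passage_cdf M W b s' - passage_cdf M W b s"
  by (intro measure_interval_measure_Ioc passage_cdf_mono passage_cdf_right_cont)

lemma emeasure_Ioc_finite: "emeasure \<mu> {s<..s'} < \<infinity>"
  by (simp add: emeasure_interval_measure_Ioc_eq passage_cdf_mono passage_cdf_right_cont)

text \<open>The cell \<open>{u<..s}\<close> contributes \<open>P(\<tau> \<in> {u<..s}, W\<^sub>t - W\<^sub>s \<le> y - b(s))\<close>; the two
  factors are independent, and \<open>W\<^sub>s \<approx> b(s)\<close> on the first event for a fine partition.\<close>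

lemma prob_cell:
  assumes "0 \<le> u" "u \<le> s" "0 < s" "s < t"
  shows "prob ((hit s - hit u) \<inter> {\<omega>\<in>space M. W t \<omega> - W s \<omega> \<le> y - b s}) =
    measure \<mu> {u<..s} * boundary_normal_cdf t y s"
proof -
  let ?B = "{\<omega>\<in>space M. W t \<omega> - W s \<omega> \<le> y - b s}"
  have B: "?B \<in> events" using assms by (intro increment_event) auto
  have "(hit s - hit u) \<inter> ?B = (hit s \<inter> ?B) - (hit u \<inter> ?B)" by auto
  then have "prob ((hit s - hit u) \<inter> ?B) = prob (hit s \<inter> ?B) - prob (hit u \<inter> ?B)"
    using hit_mono[OF assms(2)] hit_event B
    by (simp only:) (intro finite_measure_Diff Int_mono sets.Int order_refl)
  also have "\<dots> = (prob (hit s) - prob (hit u)) * prob ?B"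
    using assms by (simp add: prob_hit_Int_increment left_diff_distrib)
  also have "prob (hit s) - prob (hit u) = measure \<mu> {u<..s}"
    using assms by (simp add: measure_Ioc passage_cdf_eq)
  also have "prob ?B = boundary_normal_cdf t y s"
    using assms by (simp add: prob_increment_le boundary_normal_cdf_def)
  finally show ?thesis .
qed

lemma boundary_normal_cdf_bounds:
  assumes "0 \<le> s" "s < t"
  shows "0 \<le> boundary_normal_cdf t y s" "boundary_normal_cdf t y s \<le> 1"
proof -
  have "boundary_normal_cdf t y s = prob {\<omega>\<in>space M. W t \<omega> - W s \<omega> \<le> y - b s}"
    using assms by (simp add: prob_increment_le boundary_normal_cdf_def)
  then show "0 \<le> boundary_normal_cdf t y s" "boundary_normal_cdf t y s \<le> 1" by auto
qed

text \<open>These are Stieltjes sums: the step functions converge pointwise, by continuity for s <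
  t, and are bounded by 1 on an interval of finite measure.\<close>

lemma tendsto_integral_cell_sum:
  assumes t: "0 < t"
  shows "(\<lambda>n. \<Sum>k<n. measure \<mu> {real k * t / real (Suc n)<..real (Suc k) * t / real (Suc n)} *
      boundary_normal_cdf t y (real (Suc k) * t / real (Suc n))) \<longlonglongrightarrow>
    (LINT s:{0<..t}|\<mu>. if s < t then boundary_normal_cdf t y s else 0)"
proof -
  let ?I = "\<lambda>n k. {real k * t / real (Suc n)<..real (Suc k) * t / real (Suc n)}"
  let ?f = "\<lambda>n s. \<Sum>k<n. indicator (?I n k) s * boundary_normal_cdf t y (real (Suc k) * t / real (Suc n))"
  have sub: "?I n k \<subseteq> {0<..t}" if "k < n" for n k
  proof -
    have "real (Suc k) * t \<le> t * real (Suc n)" using that t by simp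
    then have "real (Suc k) * t / real (Suc n) \<le> t"
      by (simp add: pos_divide_le_eq del: of_nat_Suc)
    moreover have "0 \<le> real k * t / real (Suc n)" using t by simp
    ultimately show ?thesis by auto
  qed
  have "(\<lambda>n. LINT s|\<mu>. indicator {0<..t} s *\<^sub>R ?f n s) \<longlonglongrightarrow>
      (LINT s|\<mu>. indicator {0<..t} s *\<^sub>R (if s < t then boundary_normal_cdf t y s else 0))"
  proof (rule integral_dominated_convergence)
    have lim: "(\<lambda>n. indicator {0<..t} s *\<^sub>R ?f n s) \<longlonglongrightarrow>
        indicator {0<..t} s *\<^sub>R (if s < t then boundary_normal_cdf t y s else 0)" for s
      using tendsto_right_endpoint_sum[of s t "boundary_normal_cdf t y", unfolded right_endpoint_sum_def]
        isCont_boundary_normal_cdf[of s t y]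
      by (cases "s \<in> {0<..t}") (auto simp: indicator_def)
    then show "AE s in \<mu>. (\<lambda>n. indicator {0<..t} s *\<^sub>R ?f n s) \<longlonglongrightarrow>
        indicator {0<..t} s *\<^sub>R (if s < t then boundary_normal_cdf t y s else 0)"
      by (rule AE_I2)
    show "integrable \<mu> (\<lambda>s. indicator {0<..t} s *\<^sub>R 1 :: real)"
      using emeasure_Ioc_finite[of 0 t] by (simp add: integrable_indicator_iff)
    show "AE s in \<mu>. norm (indicator {0<..t} s *\<^sub>R ?f n s) \<le> indicator {0<..t} s *\<^sub>R 1" for n
    proof (rule AE_I2)
      fix s
      have "\<bar>boundary_normal_cdf t y u\<bar> \<le> 1" if "0 < u" "u < t" for u
        using boundary_normal_cdf_bounds[of u t y] that by simp
      then have "\<bar>right_endpoint_sum t n (boundary_normal_cdf t y) s\<bar> \<le> 1" if "s \<in> {0<..t}"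
        using that by (intro right_endpoint_sum_bound) auto
      then have "\<bar>?f n s\<bar> \<le> 1" if "s \<in> {0<..t}"
        using that by (simp only: right_endpoint_sum_def)
      then show "norm (indicator {0<..t} s *\<^sub>R ?f n s) \<le> indicator {0<..t} s *\<^sub>R 1"
        by (auto simp: indicator_def)
    qed
    show m: "(\<lambda>s. indicator {0<..t} s *\<^sub>R ?f n s) \<in> borel_measurable \<mu>" for n by measurable
    show "(\<lambda>s. indicator {0<..t} s *\<^sub>R (if s < t then boundary_normal_cdf t y s else 0)) \<in> borel_measurable \<mu>"
      by (rule borel_measurable_LIMSEQ_metric[OF m lim])
  qed
  also have "(\<lambda>n. LINT s|\<mu>. indicator {0<..t} s *\<^sub>R ?f n s) =
      (\<lambda>n. \<Sum>k<n. measure \<mu> (?I n k) * boundary_normal_cdf t y (real (Suc k) * t / real (Suc n)))"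
  proof
    fix n
    have "(LINT s|\<mu>. indicator {0<..t} s *\<^sub>R ?f n s) =
        (LINT s|\<mu>. ?f n s)"
    proof (rule Bochner_Integration.integral_cong[OF refl])
      fix s
      show "indicator {0<..t} s *\<^sub>R ?f n s = ?f n s"
      proof (cases "s \<in> {0<..t}")
        case False
        have "indicator (?I n k) s = (0::real)" if "k < n" for k
          using sub[OF that] False by (subst indicator_eq_0_iff) blast
        then have "?f n s = 0" by (intro sum.neutral) (simp del: of_nat_Suc)
        then show ?thesis by simp
      qed simp
    qed
    also have "\<dots> = (\<Sum>k<n. LINT s|\<mu>. indicator (?I n k) s * boundary_normal_cdf t y (real (Suc k) * t / real (Suc n)))"
      by (intro Bochner_Integration.integral_sum integrable_mult_left)
        (simp add: integrable_indicator_iff emeasure_Ioc_finite[unfolded infinity_ennreal_def] del: of_nat_Suc)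
    also have "\<dots> = (\<Sum>k<n. measure \<mu> (?I n k) * boundary_normal_cdf t y (real (Suc k) * t / real (Suc n)))"
      by (simp del: of_nat_Suc)
    finally show "(LINT s|\<mu>. indicator {0<..t} s *\<^sub>R ?f n s) =
      (\<Sum>k<n. measure \<mu> (?I n k) * boundary_normal_cdf t y (real (Suc k) * t / real (Suc n)))" .
  qed
  finally show ?thesis by (simp only: set_lebesgue_integral_def)
qed

text \<open>On a path with passage time s only the cell containing s counts, and it asks for
  \<open>W t - W v \<le> y - b v\<close> at its right endpoint v. As v tends to s,
  \<open>W s = b s\<close> turns this into \<open>W t \<le> y\<close>. Paths without contact up to t
  have \<open>W t > b t > y\<close> and give 0 on both sides.\<close>

lemma tendsto_prob_cell_sum:
  assumes t: "0 < t" and y: "y < b t"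
  shows "(\<lambda>n. \<Sum>k<n. prob ((hit (real (Suc k) * t / real (Suc n)) - hit (real k * t / real (Suc n))) \<inter>
      {\<omega>\<in>space M. W t \<omega> - W (real (Suc k) * t / real (Suc n)) \<omega> \<le> y - b (real (Suc k) * t / real (Suc n))}))
    \<longlonglongrightarrow> prob {\<omega>\<in>space M. W t \<omega> \<le> y}"
proof -
  let ?A = "\<lambda>n k. hit (real (Suc k) * t / real (Suc n)) - hit (real k * t / real (Suc n))"
  let ?B = "\<lambda>u. {\<omega>\<in>space M. W t \<omega> - W u \<omega> \<le> y - b u}"
  let ?E = "\<lambda>n k. ?A n k \<inter> ?B (real (Suc k) * t / real (Suc n))"
  let ?g = "\<lambda>n \<omega>. \<Sum>k<n. indicator (?E n k) \<omega> :: real"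
  have E: "?E n k \<in> events" for n k
    by (intro sets.Int sets.Diff hit_event increment_event) (use t in auto)
  have C: "{\<omega>\<in>space M. W t \<omega> \<le> y} \<in> events"
    using random_variable[OF less_imp_le[OF t]] by measurable
  have "(\<lambda>n. LINT \<omega>|M. ?g n \<omega>) \<longlonglongrightarrow> (LINT \<omega>|M. indicator {\<omega>\<in>space M. W t \<omega> \<le> y} \<omega>)"
  proof (rule integral_dominated_convergence)
    have first: "(\<lambda>n. ?g n \<omega>) \<longlonglongrightarrow> indicator {\<omega>\<in>space M. W t \<omega> \<le> y} \<omega> \<and> (\<forall>n. \<bar>?g n \<omega>\<bar> \<le> 1)"
      if \<omega>: "\<omega> \<in> space M" "W t \<omega> \<noteq> y" "passage_time W b \<omega> \<noteq> 0" for \<omega>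
    proof (cases "\<omega> \<in> hit t")
      case False
      have "indicator (?E n k) \<omega> = (0::real)" if "k < n" for n k
      proof -
        have "real (Suc k) * t \<le> t * real (Suc n)" using that t by simp
        then have "real (Suc k) * t / real (Suc n) \<le> t"
          by (simp add: pos_divide_le_eq del: of_nat_Suc)
        from hit_mono[OF this] False show ?thesis by (auto simp: indicator_def)
      qed
      then have "?g n \<omega> = 0" for n by (intro sum.neutral) auto
      moreover have "y < W t \<omega>" using False \<omega> t y by (force simp: hit_def)
      ultimately show ?thesis by (simp add: indicator_def)
    next
      case True
      obtain s where s: "0 < s" "s \<le> t" "W s \<omega> = b s" "\<And>u. \<omega> \<in> hit u \<longleftrightarrow> s \<le> u"
        using first_hit[OF True \<omega>(3)] by blast
      define H where "H = (\<lambda>u. indicator (?B u) \<omega> :: real)"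
      have g: "?g n \<omega> = right_endpoint_sum t n H s" for n
        unfolding right_endpoint_sum_def by (intro sum.cong refl) (auto simp: indicator_def H_def s(4) simp del: of_nat_Suc)
      have "isCont H s" if "s < t"
      proof -
        define q where "q = (\<lambda>u. W t \<omega> - W u \<omega> - (y - b u))"
        have q: "isCont q s" unfolding q_def
          by (intro continuous_intros isCont_path isCont_boundary s(1) \<omega>(1))
        have q: "(q \<longlongrightarrow> q s) (nhds s)"
          using q unfolding isCont_def by (rule iffD1[OF tendsto_at_iff_tendsto_nhds])
        have qs: "q s = W t \<omega> - y" using s(3) by (simp add: q_def)
        \<comment> \<open>The value \<open>q s = W t \<omega> - y\<close> is nonzero, so the sign of
          q, and with it the indicator H, is locally constant.\<close>
        have "\<forall>\<^sub>F u in nhds s. H u = H s"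
        proof (cases "W t \<omega> < y")
          case True
          then have "\<forall>\<^sub>F u in nhds s. q u < 0"
            using order_tendstoD(2)[OF q, of 0] qs by simp
          then show ?thesis
            using True \<omega>(1) s(3) by (auto elim!: eventually_mono simp: H_def indicator_def q_def)
        next
          case False
          then have "\<forall>\<^sub>F u in nhds s. q u > 0"
            using order_tendstoD(1)[OF q, of 0] qs \<omega>(2) by simp
          then show ?thesis
            using False \<omega>(1,2) s(3) by (auto elim!: eventually_mono simp: H_def indicator_def q_def)
        qed
        then show ?thesis by (simp add: isCont_cong)
      qed
      from tendsto_right_endpoint_sum[OF s(1,2) this]
      have "(\<lambda>n. ?g n \<omega>) \<longlonglongrightarrow> (if s < t then H s else 0)" by (simp only: g)
      \<comment> \<open>Contact at s = t gives \<open>W t \<omega> = b t > y\<close>, so the omitted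
        last cell costs nothing.\<close>
      moreover have "(if s < t then H s else 0) = indicator {\<omega>\<in>space M. W t \<omega> \<le> y} \<omega>"
        using s \<omega> y by (auto simp: H_def indicator_def)
      moreover have "\<bar>?g n \<omega>\<bar> \<le> 1" for n
        unfolding g using s by (intro right_endpoint_sum_bound) (auto simp: H_def indicator_def)
      ultimately show ?thesis by simp
    qed
    have AE: "AE \<omega> in M. W t \<omega> \<noteq> y \<and> passage_time W b \<omega> \<noteq> 0"
      using AE_path_neq[OF t, of y] AE_passage_time_nonzero by eventually_elim simp
    show "AE \<omega> in M. (\<lambda>n. ?g n \<omega>) \<longlonglongrightarrow> indicator {\<omega>\<in>space M. W t \<omega> \<le> y} \<omega>"
      using AE AE_space by eventually_elim (use first in blast)
    show "AE \<omega> in M. norm (?g n \<omega>) \<le> 1" for n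
      using AE AE_space by eventually_elim (simp only: real_norm_def, use first in blast)
    show "?g n \<in> borel_measurable M" for n
      using E by (intro borel_measurable_sum borel_measurable_indicator)
    show "indicator {\<omega>\<in>space M. W t \<omega> \<le> y} \<in> borel_measurable M" using C by simp
  qed simp
  also have "(\<lambda>n. LINT \<omega>|M. ?g n \<omega>) = (\<lambda>n. \<Sum>k<n. prob (?E n k))"
    using E by (intro ext) (simp add: Bochner_Integration.integral_sum emeasure_eq_measure del: of_nat_Suc)
  finally show ?thesis using C by simp
qed

lemma prob_le_eq_passage_integral:
  assumes t: "0 < t" and y: "y < b t"
  shows "prob {\<omega>\<in>space M. W t \<omega> \<le> y} =
    (LINT s:{0<..t}|\<mu>. if s < t then boundary_normal_cdf t y s else 0)"
proof (rule LIMSEQ_unique[OF tendsto_prob_cell_sum[OF assms]])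
  have "prob ((hit (real (Suc k) * t / real (Suc n)) - hit (real k * t / real (Suc n))) \<inter>
      {\<omega>\<in>space M. W t \<omega> - W (real (Suc k) * t / real (Suc n)) \<omega> \<le> y - b (real (Suc k) * t / real (Suc n))}) =
    measure \<mu> {real k * t / real (Suc n)<..real (Suc k) * t / real (Suc n)} *
      boundary_normal_cdf t y (real (Suc k) * t / real (Suc n))" if "k < n" for n k
  proof (rule prob_cell)
    have "real (Suc k) * t < t * real (Suc n)" using that t by simp
    then show "real (Suc k) * t / real (Suc n) < t"
      by (simp add: pos_divide_less_eq del: of_nat_Suc)
  qed (use t in \<open>auto simp: divide_right_mono\<close>)
  then have "(\<Sum>k<n. prob ((hit (real (Suc k) * t / real (Suc n)) - hit (real k * t / real (Suc n))) \<inter>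
      {\<omega>\<in>space M. W t \<omega> - W (real (Suc k) * t / real (Suc n)) \<omega> \<le> y - b (real (Suc k) * t / real (Suc n))})) =
    (\<Sum>k<n. measure \<mu> {real k * t / real (Suc n)<..real (Suc k) * t / real (Suc n)} *
      boundary_normal_cdf t y (real (Suc k) * t / real (Suc n)))" for n
    by (intro sum.cong) auto
  then show "(\<lambda>n. \<Sum>k<n. prob ((hit (real (Suc k) * t / real (Suc n)) - hit (real k * t / real (Suc n))) \<inter>
      {\<omega>\<in>space M. W t \<omega> - W (real (Suc k) * t / real (Suc n)) \<omega> \<le> y - b (real (Suc k) * t / real (Suc n))}))
    \<longlonglongrightarrow> (LINT s:{0<..t}|\<mu>. if s < t then boundary_normal_cdf t y s else 0)"
    using tendsto_integral_cell_sum[OF t, of y] by (simp only:)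
qed

end

section \<open>Changing the order of the parabolic cylinder function\<close>

text \<open>The power of r makes this, for r > 0, a self-similar solution of the heat equation
  \<partial>h/\<partial>r = (1/2) \<partial>^2 h/\<partial>x^2. For p = 0 it is
  \<open>sqrt (2 * pi)\<close> times the centred normal density of variance r.\<close>

definition heat_pcf :: "real \<Rightarrow> real \<Rightarrow> real \<Rightarrow> real" where
  "heat_pcf p r x = gauss_pcf p (x / sqrt r) / r powr ((p + 1) / 2)"

lemma heat_pcf_measurable [measurable (raw)]:
  assumes "f \<in> borel_measurable M" "g \<in> borel_measurable M"
  shows "(\<lambda>x. heat_pcf p (f x) (g x)) \<in> borel_measurable M"
  using assms unfolding heat_pcf_def by measurable

lemma heat_pcf_has_real_derivative:
  assumes "0 < r"
  shows "((\<lambda>y. heat_pcf p r (c - y)) has_real_derivative heat_pcf (p + 1) r (c - y)) (at y)"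
proof -
  have "((\<lambda>y. (c - y) / sqrt r) has_real_derivative - 1 / sqrt r) (at y)"
    by (rule DERIV_cdivide) (auto intro!: derivative_eq_intros)
  from DERIV_chain2[OF gauss_pcf_has_real_derivative this]
  have "((\<lambda>y. gauss_pcf p ((c - y) / sqrt r)) has_real_derivative
      gauss_pcf (p + 1) ((c - y) / sqrt r) / sqrt r) (at y)" by simp
  then have "((\<lambda>y. heat_pcf p r (c - y)) has_real_derivative
      gauss_pcf (p + 1) ((c - y) / sqrt r) / sqrt r / r powr ((p + 1) / 2)) (at y)"
    unfolding heat_pcf_def by (rule DERIV_cdivide)
  moreover have "sqrt r * r powr ((p + 1) / 2) = r powr ((p + 1 + 1) / 2)"
    using assms by (simp add: powr_half_sqrt[symmetric] powr_add[symmetric] add_divide_distrib)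
  ultimately show ?thesis by (simp add: heat_pcf_def)
qed

lemma heat_pcf_bounded_far:
  assumes "q > -1" "\<epsilon> > 0"
  obtains K where "\<And>r x. r \<ge> \<epsilon> \<Longrightarrow> \<bar>heat_pcf q r x\<bar> \<le> K"
proof -
  obtain C where C: "\<And>x. \<bar>gauss_pcf q x\<bar> \<le> C" using gauss_pcf_bounded[OF assms(1)] by blast
  have "\<bar>heat_pcf q r x\<bar> \<le> C / \<epsilon> powr ((q + 1) / 2)" if "r \<ge> \<epsilon>" for r x
  proof -
    have "\<epsilon> powr ((q + 1) / 2) \<le> r powr ((q + 1) / 2)"
      using that assms by (intro powr_mono2) auto
    moreover have "0 \<le> C" using C[of 0] by linarith
    ultimately show ?thesis
      unfolding heat_pcf_def abs_divide using C[of "x / sqrt r"] assms by (intro frac_le) auto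
  qed
  then show ?thesis using that by blast
qed

text \<open>With \<open>z = x / sqrt r\<close> the kernel is
  \<open>gauss_pcf q z * z powr (q + 1) / x powr (q + 1)\<close>: decay in z offsets the singularity
  at r = 0, uniformly for x bounded away from 0.\<close>

lemma heat_pcf_bounded_near:
  assumes "q > -1" "\<delta> > 0"
  obtains K where "\<And>r x. r > 0 \<Longrightarrow> x \<ge> \<delta> \<Longrightarrow> \<bar>heat_pcf q r x\<bar> \<le> K"
proof -
  obtain C where C: "\<And>x. x > 0 \<Longrightarrow> \<bar>gauss_pcf q x\<bar> * x powr (q + 1) \<le> C"
    using gauss_pcf_decay[OF assms(1)] by blast
  have "\<bar>heat_pcf q r x\<bar> \<le> C / \<delta> powr (q + 1)" if "r > 0" "x \<ge> \<delta>" for r x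
  proof -
    have x: "x > 0" using that assms by simp
    have "sqrt r powr (q + 1) = r powr ((q + 1) / 2)"
      using that by (simp add: powr_half_sqrt[symmetric] powr_powr)
    then have "\<bar>heat_pcf q r x\<bar> = \<bar>gauss_pcf q (x / sqrt r)\<bar> * (x / sqrt r) powr (q + 1) / x powr (q + 1)"
      using that x by (simp add: heat_pcf_def powr_divide)
    also have "\<dots> \<le> C / \<delta> powr (q + 1)"
    proof (rule frac_le)
      show "0 \<le> C" using C[of 1] by (smt (verit) mult_nonneg_nonneg powr_ge_zero)
      show "\<bar>gauss_pcf q (x / sqrt r)\<bar> * (x / sqrt r) powr (q + 1) \<le> C"
        using that x by (intro C) simp
      show "\<delta> powr (q + 1) \<le> x powr (q + 1)" using that assms by (intro powr_mono2) auto
    qed (use assms in auto)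
    finally show ?thesis .
  qed
  then show ?thesis using that by blast
qed

lemma heat_pcf_0: "0 < r \<Longrightarrow> heat_pcf 0 r x = exp (- (x / sqrt r)\<^sup>2 / 2) / sqrt r"
  by (simp add: heat_pcf_def gauss_pcf_0 powr_half_sqrt)

lemma nn_integral_gauss_pcf_neg:
  assumes "q < 0"
  shows "(\<integral>\<^sup>+u. ennreal (indicator {0<..} u * (u powr (- q - 1) / Gamma (- q) * exp (- (z + u)\<^sup>2 / 2))) \<partial>lborel)
    = ennreal (gauss_pcf q z)"
proof -
  have G: "Gamma (- q) > 0" using assms by simp
  have "set_integrable lborel {0<..} (\<lambda>u. (exp (- z\<^sup>2 / 2) / Gamma (- q)) * (u powr (- q - 1) * exp (- z * u - u\<^sup>2 / 2)))"
    using weber_integrable[of "- q" z] assms by (intro set_integrable_mult_right) auto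
  moreover have "exp (- z\<^sup>2 / 2) * exp (- z * u - u\<^sup>2 / 2) = exp (- (z + u)\<^sup>2 / 2)" for u
    by (simp add: exp_add[symmetric] power2_eq_square field_simps)
  then have "(exp (- z\<^sup>2 / 2) / Gamma (- q)) * (u powr (- q - 1) * exp (- z * u - u\<^sup>2 / 2)) =
      u powr (- q - 1) / Gamma (- q) * exp (- (z + u)\<^sup>2 / 2)" for u
    by (metis (no_types, opaque_lifting) mult.commute mult.left_commute times_divide_eq_left times_divide_eq_right)
  ultimately have "integrable lborel (\<lambda>u. indicator {0<..} u * (u powr (- q - 1) / Gamma (- q) * exp (- (z + u)\<^sup>2 / 2)))"
    by (simp only: set_integrable_def real_scaleR_def)
  then have "(\<integral>\<^sup>+u. ennreal (indicator {0<..} u * (u powr (- q - 1) / Gamma (- q) * exp (- (z + u)\<^sup>2 / 2))) \<partial>lborel) =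
      ennreal (\<integral>u. indicator {0<..} u * (u powr (- q - 1) / Gamma (- q) * exp (- (z + u)\<^sup>2 / 2)) \<partial>lborel)"
    by (rule nn_integral_eq_integral) (use less_imp_le[OF G] in auto)
  also have "(\<integral>u. indicator {0<..} u * (u powr (- q - 1) / Gamma (- q) * exp (- (z + u)\<^sup>2 / 2)) \<partial>lborel) =
      (\<integral>u. (indicator {0<..} u *\<^sub>R (u powr (- q - 1) * exp (- (z + u)\<^sup>2 / 2))) / Gamma (- q) \<partial>lborel)"
    by (intro Bochner_Integration.integral_cong) auto
  also have "\<dots> = gauss_pcf q z"
    by (simp only: integral_divide_zero gauss_pcf_neg[OF assms] set_lebesgue_integral_def)
  finally show ?thesis .
qed

text \<open>The mixture formula rescaled by \<open>u = sqrt r * v\<close>; the Jacobian cancels the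
  \<open>1 / sqrt r\<close> in \<open>heat_pcf 0\<close>. Nonnegative integrals are the form that
  Tonelli's theorem needs.\<close>

lemma nn_integral_heat_pcf_neg:
  assumes "q < 0" and r: "0 < r"
  shows "(\<integral>\<^sup>+u. ennreal (indicator {0<..} u * (u powr (- q - 1) / Gamma (- q) * heat_pcf 0 r (x + u))) \<partial>lborel)
    = ennreal (heat_pcf q r x)"
proof -
  let ?f = "\<lambda>u. indicator {0<..} u * (u powr (- q - 1) / Gamma (- q) * heat_pcf 0 r (x + u)) :: real"
  let ?g = "\<lambda>v. indicator {0<..} v * (v powr (- q - 1) / Gamma (- q) * exp (- (x / sqrt r + v)\<^sup>2 / 2)) :: real"
  have s: "sqrt r > 0" using r by simp
  have eq: "sqrt r * ?f (0 + sqrt r * v) = inverse (r powr ((q + 1) / 2)) * ?g v" for v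
  proof (cases "v > 0")
    case True
    have "(sqrt r * v) powr (- q - 1) = inverse (r powr ((q + 1) / 2)) * v powr (- q - 1)"
    proof -
      have "sqrt r powr (- q - 1) = r powr (- ((q + 1) / 2))"
      proof -
        have "sqrt r powr (- q - 1) = r powr ((1 / 2) * (- q - 1))"
          using r by (simp only: powr_half_sqrt[OF less_imp_le, symmetric] powr_powr)
        also have "(1 / 2) * (- q - 1) = - ((q + 1) / 2)" by (simp add: field_simps)
        finally show ?thesis .
      qed
      then show ?thesis using r True by (simp add: powr_mult powr_minus)
    qed
    moreover have "(x + sqrt r * v) / sqrt r = x / sqrt r + v" using s by (simp add: field_simps)
    ultimately show ?thesis using True r by (simp add: heat_pcf_0)
  qed (use s in \<open>simp add: zero_less_mult_iff\<close>)
  have "(\<integral>\<^sup>+u. ennreal (?f u) \<partial>lborel) = ennreal \<bar>sqrt r\<bar> * (\<integral>\<^sup>+v. ennreal (?f (0 + sqrt r * v)) \<partial>lborel)"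
    using s by (intro nn_integral_real_affine) auto
  also have "\<dots> = (\<integral>\<^sup>+v. ennreal (sqrt r) * ennreal (?f (0 + sqrt r * v)) \<partial>lborel)"
    using s by (subst nn_integral_cmult) auto
  also have "\<dots> = (\<integral>\<^sup>+v. ennreal (inverse (r powr ((q + 1) / 2))) * ennreal (?g v) \<partial>lborel)"
    unfolding ennreal_mult'[symmetric, OF less_imp_le[OF s]]
      ennreal_mult'[symmetric, of "inverse (r powr ((q + 1) / 2))", simplified] eq ..
  also have "\<dots> = ennreal (inverse (r powr ((q + 1) / 2))) * (\<integral>\<^sup>+v. ennreal (?g v) \<partial>lborel)"
    by (rule nn_integral_cmult) auto
  also have "\<dots> = ennreal (inverse (r powr ((q + 1) / 2))) * ennreal (gauss_pcf q (x / sqrt r))"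
    by (simp only: nn_integral_gauss_pcf_neg[OF assms(1)])
  also have "\<dots> = ennreal (inverse (r powr ((q + 1) / 2)) * gauss_pcf q (x / sqrt r))"
    by (rule ennreal_mult'[symmetric]) simp
  also have "inverse (r powr ((q + 1) / 2)) * gauss_pcf q (x / sqrt r) = heat_pcf q r x"
    unfolding heat_pcf_def divide_inverse by (rule mult.commute)
  finally show ?thesis .
qed

lemma gauss_pcf_neg_nonneg: "q < 0 \<Longrightarrow> 0 \<le> gauss_pcf q z"
  unfolding gauss_pcf_neg set_lebesgue_integral_def
  by (intro divide_nonneg_nonneg integral_nonneg) (auto simp: Gamma_real_nonneg)

lemma heat_pcf_nonneg: "q < 0 \<Longrightarrow> 0 \<le> heat_pcf q r x"
  by (simp add: heat_pcf_def gauss_pcf_neg_nonneg)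

context regular_brownian_boundary
begin

definition passage_kernel :: "real \<Rightarrow> real \<Rightarrow> real \<Rightarrow> real \<Rightarrow> real" where
  "passage_kernel p t y s = indicator {0<..<t} s * heat_pcf p (t - s) (b s - y)"

text \<open>Integrability is included because the Bochner integral of a nonintegrable function is 0
  by convention; differentiation in y needs it too.\<close>

definition passage_identity :: "real \<Rightarrow> real \<Rightarrow> real \<Rightarrow> bool" where
  "passage_identity p t y \<longleftrightarrow> has_bochner_integral \<mu> (passage_kernel p t y) (heat_pcf p t (- y))"

text \<open>Cutting b off outside \<open>{0<..}\<close> changes nothing under the indicator and
  yields a function that is Borel on the whole line.\<close>

lemma passage_kernel_eq:
  "passage_kernel p t y s =
    indicator {0<..<t} s * heat_pcf p (t - s) (indicator {0<..} s *\<^sub>R b s - y)"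
  by (auto simp: passage_kernel_def indicator_def)

lemma passage_kernel_measurable [measurable]:
  "(\<lambda>(y, s). passage_kernel p t y s) \<in> borel_measurable (borel \<Otimes>\<^sub>M borel)"
proof -
  have [measurable]: "(\<lambda>s. indicator {0<..} s *\<^sub>R b s) \<in> borel_measurable borel"
    by (rule borel_measurable_continuous_on_indicator[OF _ boundary_continuous]) simp
  show ?thesis unfolding passage_kernel_eq by measurable
qed

lemma passage_kernel_measurable1 [measurable]: "passage_kernel p t y \<in> borel_measurable borel"
  using measurable_Pair2[OF passage_kernel_measurable, of y p t] by simp

lemma integrable_passage_indicator: "integrable \<mu> (\<lambda>s. indicator {0<..<t} s * K)" for K :: real
proof -
  have "emeasure \<mu> {0<..<t} \<le> emeasure \<mu> {0<..t}" by (intro emeasure_mono) auto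
  then have "emeasure \<mu> {0<..<t} < \<infinity>" using emeasure_Ioc_finite[of 0 t] by (rule le_less_trans)
  then show ?thesis by (intro integrable_mult_left) (simp add: integrable_indicator_iff)
qed

lemma passage_identity_minus_one:
  assumes t: "0 < t" and y: "y < b t"
  shows "passage_identity (-1) t y"
proof -
  have k: "passage_kernel (-1) t y s = sqrt (2 * pi) *
      (indicator {0<..t} s *\<^sub>R (if s < t then boundary_normal_cdf t y s else 0))" for s
    by (auto simp: passage_kernel_def heat_pcf_def boundary_normal_cdf_def indicator_def)
  have "integrable \<mu> (passage_kernel (-1) t y)"
  proof (rule Bochner_Integration.integrable_bound[OF integrable_passage_indicator[of t "sqrt (2 * pi)"]])
    show "AE s in \<mu>. norm (passage_kernel (-1) t y s) \<le> norm (indicator {0<..<t} s * sqrt (2 * pi))"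
    proof (rule AE_I2)
      fix s
      show "norm (passage_kernel (-1) t y s) \<le> norm (indicator {0<..<t} s * sqrt (2 * pi))"
      proof (cases "s \<in> {0<..<t}")
        case True
        with boundary_normal_cdf_bounds[of s t y]
        have "sqrt (2 * pi) * \<bar>boundary_normal_cdf t y s\<bar> \<le> sqrt (2 * pi) * 1"
          by (intro mult_left_mono) auto
        with True show ?thesis unfolding k by (simp add: abs_mult)
      qed (auto simp: k indicator_def)
    qed
  qed simp
  moreover have "(\<integral>s. passage_kernel (-1) t y s \<partial>\<mu>) = heat_pcf (-1) t (- y)"
  proof -
    have "(\<integral>s. passage_kernel (-1) t y s \<partial>\<mu>) = sqrt (2 * pi) * prob {\<omega>\<in>space M. W t \<omega> \<le> y}"
      unfolding k integral_mult_right_zero prob_le_eq_passage_integral[OF assms] set_lebesgue_integral_def ..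
    also have "{\<omega>\<in>space M. W t \<omega> \<le> y} = {\<omega>\<in>space M. W t \<omega> - W 0 \<omega> \<le> y}"
      using start_zero by auto
    also have "prob \<dots> = gauss_pcf (-1) (- y / sqrt t) / sqrt (2 * pi)"
      using prob_increment_le[of 0 t y] t by simp
    finally show ?thesis using t by (simp add: heat_pcf_def)
  qed
  ultimately show ?thesis by (simp add: passage_identity_def has_bochner_integral_iff)
qed

text \<open>If t - s is at least \<epsilon>, boundedness of \<open>gauss_pcf\<close> suffices. For s
  near t, continuity of b keeps \<open>b s - y'\<close> at least \<delta>, and the decay of
  \<open>gauss_pcf\<close> controls the singularity.\<close>

lemma passage_kernel_bounded:
  assumes q: "q > -1" and t: "0 < t" and y: "y < b t"
  obtains \<delta> K where "\<delta> > 0" "\<And>s y'. 0 < s \<Longrightarrow> s < t \<Longrightarrow> \<bar>y' - y\<bar> < \<delta> \<Longrightarrow> \<bar>heat_pcf q (t - s) (b s - y')\<bar> \<le> K"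
proof -
  \<comment> \<open>One third of the gap for the variation of b near t, one for that of y', one left
    as the distance between them.\<close>
  define \<delta> where "\<delta> = (b t - y) / 3"
  have \<delta>: "\<delta> > 0" using y by (simp add: \<delta>_def)
  have "(b \<longlongrightarrow> b t) (nhds t)"
    using isCont_boundary[OF t] unfolding isCont_def by (rule iffD1[OF tendsto_at_iff_tendsto_nhds])
  from order_tendstoD(1)[OF this, of "b t - \<delta>"] \<delta>
  obtain \<epsilon> where \<epsilon>: "\<epsilon> > 0" "\<And>s. dist s t < \<epsilon> \<Longrightarrow> b t - \<delta> < b s"
    by (auto simp: eventually_nhds_metric)
  obtain K1 where K1: "\<And>r x. r \<ge> \<epsilon> \<Longrightarrow> \<bar>heat_pcf q r x\<bar> \<le> K1"
    using heat_pcf_bounded_far[OF q \<epsilon>(1)] by blast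
  obtain K2 where K2: "\<And>r x. r > 0 \<Longrightarrow> x \<ge> \<delta> \<Longrightarrow> \<bar>heat_pcf q r x\<bar> \<le> K2"
    using heat_pcf_bounded_near[OF q \<delta>] by blast
  have "\<bar>heat_pcf q (t - s) (b s - y')\<bar> \<le> max K1 K2" if "0 < s" "s < t" "\<bar>y' - y\<bar> < \<delta>" for s y'
  proof (cases "t - s \<ge> \<epsilon>")
    case True
    from K1[OF this, of "b s - y'"] show ?thesis by simp
  next
    case False
    then have "b t - \<delta> < b s" using that by (intro \<epsilon>) (simp add: dist_real_def)
    moreover have "3 * \<delta> = b t - y" by (simp add: \<delta>_def)
    ultimately have "b s - y' \<ge> \<delta>" using that(3) by linarith
    with K2[of "t - s" "b s - y'"] that show ?thesis by simp
  qed
  with \<delta> that show ?thesis by blast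
qed

text \<open>By the mean value theorem the difference quotients in y are values of the kernel of
  order p + 1, so its bound near y dominates them; that bound requires p + 1 > -1.\<close>

lemma passage_identity_step:
  assumes p: "p > -2" and t: "0 < t" and y: "y < b t"
    and id: "\<And>y'. y' < b t \<Longrightarrow> passage_identity p t y'"
  shows "passage_identity (p + 1) t y"
proof -
  have "p + 1 > -1" using p by simp
  from passage_kernel_bounded[OF this t y] obtain \<delta> K where \<delta>: "\<delta> > 0"
    and K: "\<And>s y'. 0 < s \<Longrightarrow> s < t \<Longrightarrow> \<bar>y' - y\<bar> < \<delta> \<Longrightarrow> \<bar>heat_pcf (p + 1) (t - s) (b s - y')\<bar> \<le> K"
    by blast
  \<comment> \<open>Negative steps keep \<open>y + h n\<close> below \<open>b t\<close>; the offset
    2 makes the size less than \<delta> already at n = 0.\<close>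
  define h where "h = (\<lambda>n. - (\<delta> / real (n + 2)))"
  have h0: "h n < 0" for n using \<delta> by (simp add: h_def)
  have hd: "\<bar>h n\<bar> < \<delta>" for n
  proof -
    have "\<delta> / real (n + 2) < \<delta> / 1" using \<delta> by (intro divide_strict_left_mono) auto
    then show ?thesis using \<delta> by (simp add: h_def)
  qed
  have "(\<lambda>n. \<delta> / real (n + 2)) \<longlonglongrightarrow> 0"
    by (rule LIMSEQ_ignore_initial_segment[OF lim_const_over_n])
  then have "h \<longlonglongrightarrow> - 0" unfolding h_def by (rule tendsto_minus)
  then have h: "filterlim h (at 0) sequentially"
    using h0 by (auto simp: filterlim_at less_imp_neq)
  have quot: "(\<lambda>n. (f (y + h n) - f y) / h n) \<longlonglongrightarrow> D" if "(f has_real_derivative D) (at y)" for f D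
    by (rule filterlim_compose[OF that[unfolded DERIV_def] h])
  let ?q = "\<lambda>n s. (passage_kernel p t (y + h n) s - passage_kernel p t y s) / h n"
  have int: "integrable \<mu> (passage_kernel p t y')" "(\<integral>s. passage_kernel p t y' s \<partial>\<mu>) = heat_pcf p t (- y')"
    if "y' < b t" for y'
    using id[OF that] by (auto simp: passage_identity_def has_bochner_integral_iff)
  have yh: "y + h n < b t" for n using h0[of n] y by linarith
  have lim: "(\<lambda>n. ?q n s) \<longlonglongrightarrow> passage_kernel (p + 1) t y s" for s
  proof (cases "s \<in> {0<..<t}")
    case True
    then show ?thesis
      using quot[OF heat_pcf_has_real_derivative[of "t - s" p "b s" y]] by (simp add: passage_kernel_def)
  qed (simp add: passage_kernel_def)
  have bound: "norm (?q n s) \<le> indicator {0<..<t} s * K" for n s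
  proof (cases "s \<in> {0<..<t}")
    case True
    obtain \<xi> where \<xi>: "y + h n < \<xi>" "\<xi> < y"
      "heat_pcf p (t - s) (b s - y) - heat_pcf p (t - s) (b s - (y + h n)) =
        (y - (y + h n)) * heat_pcf (p + 1) (t - s) (b s - \<xi>)"
      using MVT2[of "y + h n" y "\<lambda>y. heat_pcf p (t - s) (b s - y)" "\<lambda>y. heat_pcf (p + 1) (t - s) (b s - y)"]
        h0[of n] heat_pcf_has_real_derivative[of "t - s"] True by auto
    have "?q n s = heat_pcf (p + 1) (t - s) (b s - \<xi>)"
      using True \<xi>(3) h0[of n] by (simp add: passage_kernel_def field_simps)
    moreover have "\<bar>\<xi> - y\<bar> < \<delta>" using \<xi>(1,2) hd[of n] h0[of n] by linarith
    ultimately show ?thesis using K[of s \<xi>] True by simp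
  qed (simp add: passage_kernel_def)
  have meas: "passage_kernel (p + 1) t y \<in> borel_measurable \<mu>" "?q n \<in> borel_measurable \<mu>" for n
    by measurable
  note dom = meas integrable_passage_indicator[of t K] AE_I2[OF lim] AE_I2[OF bound]
  have conv: "integrable \<mu> (passage_kernel (p + 1) t y)"
    "(\<lambda>n. \<integral>s. ?q n s \<partial>\<mu>) \<longlonglongrightarrow> (\<integral>s. passage_kernel (p + 1) t y s \<partial>\<mu>)"
    by (rule integrable_dominated_convergence[OF dom], rule integral_dominated_convergence[OF dom])
  \<comment> \<open>Writing \<open>0 - y\<close> makes the other side an instance of the same
    derivative rule, with c = 0.\<close>
  moreover have "(\<integral>s. ?q n s \<partial>\<mu>) = (heat_pcf p t (0 - (y + h n)) - heat_pcf p t (0 - y)) / h n" for n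
    using int[OF yh[of n]] int[OF y] by simp
  then have "(\<lambda>n. \<integral>s. ?q n s \<partial>\<mu>) \<longlonglongrightarrow> heat_pcf (p + 1) t (0 - y)"
    using quot[OF heat_pcf_has_real_derivative[OF t, of p 0 y]] by (simp only:)
  ultimately have "(\<integral>s. passage_kernel (p + 1) t y s \<partial>\<mu>) = heat_pcf (p + 1) t (- y)"
    using LIMSEQ_unique by fastforce
  with conv(1) show ?thesis by (simp add: passage_identity_def has_bochner_integral_iff)
qed

lemma sigma_finite_passage: "sigma_finite_measure \<mu>"
  by (intro sigma_finite_interval_measure passage_cdf_mono passage_cdf_right_cont)

text \<open>The kernel of order q mixes kernels of order 0 at y - u with u > 0, and these points
  stay below \<open>b t\<close>, so the known identity applies to each u. All terms are nonnegative,
  so the integrals may be exchanged freely; finiteness of the result then gives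
  integrability.\<close>

lemma passage_identity_neg:
  assumes q: "q < 0" and t: "0 < t" and y: "y < b t"
    and id: "\<And>y'. y' < b t \<Longrightarrow> passage_identity 0 t y'"
  shows "passage_identity q t y"
proof -
  interpret \<mu>: sigma_finite_measure \<mu> by (rule sigma_finite_passage)
  interpret P: pair_sigma_finite lborel \<mu> ..
  let ?c = "\<lambda>u. indicator {0<..} u * (u powr (- q - 1) / Gamma (- q)) :: real"
  have c0: "0 \<le> ?c u" for u using q by (simp add: Gamma_real_nonneg)
  have k0: "0 \<le> passage_kernel 0 t y' s" for y' s
    by (auto simp: passage_kernel_def heat_pcf_0 indicator_def)
  have kq: "0 \<le> passage_kernel q t y s" for s
    using q by (simp add: passage_kernel_def heat_pcf_nonneg)
  have inner: "ennreal (passage_kernel q t y s) = (\<integral>\<^sup>+u. ennreal (?c u * passage_kernel 0 t (y - u) s) \<partial>lborel)" for s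
  proof (cases "s \<in> {0<..<t}")
    case True
    have "ennreal (passage_kernel q t y s) = ennreal (heat_pcf q (t - s) (b s - y))"
      using True by (simp add: passage_kernel_def)
    also have "\<dots> = (\<integral>\<^sup>+u. ennreal (indicator {0<..} u * (u powr (- q - 1) / Gamma (- q) *
        heat_pcf 0 (t - s) (b s - y + u))) \<partial>lborel)"
      using True by (intro nn_integral_heat_pcf_neg[symmetric] q) simp
    also have "\<dots> = (\<integral>\<^sup>+u. ennreal (?c u * passage_kernel 0 t (y - u) s) \<partial>lborel)"
      using True by (intro nn_integral_cong) (simp add: passage_kernel_def algebra_simps)
    finally show ?thesis .
  qed (simp add: passage_kernel_def)
  have "(\<integral>\<^sup>+s. ennreal (passage_kernel q t y s) \<partial>\<mu>) =
      (\<integral>\<^sup>+s. \<integral>\<^sup>+u. ennreal (?c u * passage_kernel 0 t (y - u) s) \<partial>lborel \<partial>\<mu>)"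
    by (simp only: inner)
  also have "\<dots> = (\<integral>\<^sup>+u. \<integral>\<^sup>+s. ennreal (?c u * passage_kernel 0 t (y - u) s) \<partial>\<mu> \<partial>lborel)"
  proof (rule P.Fubini')
    have [measurable]: "(\<lambda>x. passage_kernel 0 t (y - fst x) (snd x)) \<in> borel_measurable (lborel \<Otimes>\<^sub>M \<mu>)"
      using measurable_compose[OF _ passage_kernel_measurable[of 0 t], of "\<lambda>x. (y - fst x, snd x)" "lborel \<Otimes>\<^sub>M \<mu>"]
      by simp
    show "(\<lambda>(u, s). ennreal (?c u * passage_kernel 0 t (y - u) s)) \<in> borel_measurable (lborel \<Otimes>\<^sub>M \<mu>)"
      by (simp add: split_beta')
  qed
  also have "\<dots> = (\<integral>\<^sup>+u. ennreal (indicator {0<..} u * (u powr (- q - 1) / Gamma (- q) * heat_pcf 0 t (- y + u))) \<partial>lborel)"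
  proof (rule nn_integral_cong)
    fix u :: real
    show "(\<integral>\<^sup>+s. ennreal (?c u * passage_kernel 0 t (y - u) s) \<partial>\<mu>) =
        ennreal (indicator {0<..} u * (u powr (- q - 1) / Gamma (- q) * heat_pcf 0 t (- y + u)))"
    proof (cases "u > 0")
      case True
      have "passage_identity 0 t (y - u)" using True y by (intro id) simp
      then have "(\<integral>\<^sup>+s. ennreal (passage_kernel 0 t (y - u) s) \<partial>\<mu>) = ennreal (heat_pcf 0 t (- (y - u)))"
        using k0 unfolding passage_identity_def has_bochner_integral_iff
        by (auto simp: nn_integral_eq_integral)
      then have "(\<integral>\<^sup>+s. ennreal (?c u) * ennreal (passage_kernel 0 t (y - u) s) \<partial>\<mu>) =
          ennreal (?c u) * ennreal (heat_pcf 0 t (- (y - u)))"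
        by (subst nn_integral_cmult) auto
      then have "(\<integral>\<^sup>+s. ennreal (?c u * passage_kernel 0 t (y - u) s) \<partial>\<mu>) =
          ennreal (?c u * heat_pcf 0 t (- (y - u)))"
        by (simp only: ennreal_mult'[OF c0])
      then show ?thesis by (simp only: mult.assoc minus_diff_eq) (simp add: algebra_simps)
    qed simp
  qed
  also have "\<dots> = ennreal (heat_pcf q t (- y))"
    by (rule nn_integral_heat_pcf_neg[OF q t])
  finally have "(\<integral>\<^sup>+s. ennreal (passage_kernel q t y s) \<partial>\<mu>) = ennreal (heat_pcf q t (- y))" .
  then show ?thesis
    unfolding passage_identity_def using kq heat_pcf_nonneg[OF q]
    by (intro has_bochner_integral_nn_integral) auto
qed

text \<open>Order 0 is one step above -1 and yields all negative orders. For p \<ge> 0 the induction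
  raises p - 1 to p, where p - 1 \<ge> -1 meets the condition of the step.\<close>

lemma passage_identity:
  assumes t: "0 < t" and "y < b t"
  shows "passage_identity p t y"
proof -
  have zero: "passage_identity 0 t y" if "y < b t" for y
    using passage_identity_step[of "-1" t y] passage_identity_minus_one[OF t] t that by simp
  have "passage_identity p t y" if "p < real n" "y < b t" for n p y
    using that
  proof (induction n arbitrary: p y)
    case 0
    then show ?case using passage_identity_neg[OF _ t] zero by simp
  next
    case (Suc n)
    show ?case
    proof (cases "p < 0")
      case True
      then show ?thesis using passage_identity_neg[OF _ t] zero Suc.prems by simp
    next
      case False
      have "passage_identity (p - 1) t y'" if "y' < b t" for y'
        using Suc.prems that by (intro Suc.IH) auto
      with passage_identity_step[of "p - 1" t y] False t Suc.prems show ?thesis by simp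
    qed
  qed
  moreover obtain n :: nat where "p < real n" using reals_Archimedean2 by blast
  ultimately show ?thesis using assms by blast
qed

end

theorem theorem2:
  fixes M :: "'a measure" and W :: "real \<Rightarrow> 'a \<Rightarrow> real"
    and b :: "real \<Rightarrow> real" and b0 :: ereal and p t y :: real
  assumes "standard_brownian_motion M W"
    and "continuous_on {0<..} b"
    and "((\<lambda>s. ereal (b s)) \<longlongrightarrow> b0) (at_right 0)"
    and "b0 \<le> 0"
    and "measure M {\<omega> \<in> space M. passage_time W b \<omega> = 0} = 0"
    and "b0 = - \<infinity> \<Longrightarrow> \<exists>\<epsilon>>0. mono_on {0<..\<epsilon>} b"
    and "0 < t"
    and "y < b t"
  defines "integrand \<equiv> \<lambda>s.
      if s < t then
        exp (- (b s - y)\<^sup>2 / (4 * (t - s)))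
          * (parabolic_cylinder_real p ((b s - y) / sqrt (t - s)) / (t - s) powr ((p + 1) / 2))
      else 0"
  shows "set_integrable (interval_measure (passage_cdf M W b)) {0<..t} integrand \<and>
    exp (- y\<^sup>2 / (4 * t)) * parabolic_cylinder_real p (- y / sqrt t) / t powr ((p + 1) / 2)
      = (LINT s:{0<..t}|interval_measure (passage_cdf M W b). integrand s)"
proof -
  interpret standard_brownian_motion M W by fact
  interpret regular_brownian_boundary M W b
    using assms(2,5) by unfold_locales
  have pcf: "heat_pcf p r x =
      exp (- x\<^sup>2 / (4 * r)) * (parabolic_cylinder_real p (x / sqrt r) / r powr ((p + 1) / 2))"
    if "0 < r" for r x
    using that by (simp add: heat_pcf_def gauss_pcf_def power_divide mult.commute)
  have "indicator {0<..t} s *\<^sub>R integrand s = passage_kernel p t y s" for s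
    by (auto simp: integrand_def passage_kernel_def indicator_def pcf)
  moreover have "heat_pcf p t (- y) =
      exp (- y\<^sup>2 / (4 * t)) * parabolic_cylinder_real p (- y / sqrt t) / t powr ((p + 1) / 2)"
    using pcf[OF assms(7), of "- y"] by simp
  ultimately show ?thesis
    using passage_identity[OF assms(7,8), of p]
    by (simp add: passage_identity_def has_bochner_integral_iff set_integrable_def set_lebesgue_integral_def)
qed

end
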